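(* Let $(\mathbb{K},|\cdot|)$ be a complete normed field, $f\in\mathbb{K}[z]$ a polynomial of degree $n\ge 2$ and $1\le p\le\infty$. Let $a=(n-1)^{1/q}$, $b=2^{1/q}$ and define $$\gamma(t)=1+at,\qquad\psi(t)=1-bt-abt^2,$$ $$\beta(t)=\frac{at^2(1+at)(1+a+at)}{(1-at)(1-t-at^2)}\left(1+\frac{at(1+at)}{(n-1)(1-bt-abt^2)}\right)^{n-1},$$ $$\phi(t)=\frac{\beta(t)}{\psi(t)}=\frac{at^2(1+at)(1+a+at)}{(1-at)(1-t-at^2)(1-bt-abt^2)}\left(1+\frac{at(1+at)}{(n-1)(1-bt-abt^2)}\right)^{n-1}.$$ Suppose $x^{(0)}\in\mathbb{K}^n$ is an initial guess with distinct components satisfying $$E_f(x^{(0)})<\min\left\{\frac1a,\frac{2}{b+\sqrt{b^2+4ab}}\right\}\quad\text{and}\quad\phi(E_f(x^{(0)}))\le 1.$$ Then the following hold. (i) Starting from $x^{(0)}$, the Dochev-Byrnev iteration $x^{(k+1)}=\mathcal{F}(x^{(k)})$, $k=0,1,2,\ldots$, is well-defined, remains in the closed ball $\overline{U}(x^{(0)},\rho)$ and converges to a root vector $\xi$ of $f$, where $\rho=\frac{\gamma(E_f(x^{(0)}))}{1-\beta(E_f(x^{(0)}))}\,\|W_f(x^{(0)})\|$. Besides, the convergence is cubic provided that $\phi(E_f(x^{(0)}))<1$. (ii) For all $k\ge 0$, $$\|x^{(k)}-\xi\|\preceq A_k\,\frac{\theta^k\lambda^{(3^k-1)/2}}{1-\theta\lambda^{3^k}}\,\|W_f(x^{(0)})\|,$$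 where $\lambda=\phi(E_f(x^{(0)}))$, $\theta=\psi(E_f(x^{(0)}))$ and $A_k=\gamma\big(E_f(x^{(0)})\lambda^{(3^k-1)/2}\big)$. (iii) For all $k\ge 0$, $$\|x^{(k)}-\xi\|\preceq\frac{\gamma(E_f(x^{(k)}))}{1-\beta(E_f(x^{(k)}))}\,\|W_f(x^{(k)})\|.$$ (iv) For all $k\ge 0$, $$\|x^{(k+1)}-\xi\|\preceq\frac{\theta_k\lambda_k}{1-\theta_k(\lambda_k)^3}\,\gamma(E_f(x^{(k+1)}))\,\|W_f(x^{(k)})\|,$$ where $\lambda_k=\phi(E_f(x^{(k)}))$ and $\theta_k=\psi(E_f(x^{(k)}))$. (v) If $\phi(E_f(x^{(0)}))<1$, then $f$ has $n$ simple zeros in $\mathbb{K}$ and for every $k\ge 0$ the closed disks $D_i^k=\{z\in\mathbb{K}:|z-x_i^{(k)}|\le r_i^{(k)}\}$, $i=1,\ldots,n$, where $r_i^{(k)}=\frac{\gamma(E_f(x^{(k)}))}{1-\beta(E_f(x^{(k)}))}\,|W_i(x^{(k)})|$, are mutually disjoint and each of them contains exactly one zero of $f$.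
   Context: A complete normed field $(\mathbb{K},|\cdot|)$ is a field with an absolute value (multiplicative, satisfying the triangle inequality) which is complete as a metric space. $\mathbb{R}_+=[0,\infty)$. For $1\le p\le\infty$, $\|x\|_p=(\sum_i|x_i|^p)^{1/p}$ (maximum norm if $p=\infty$); $q$ is the conjugate exponent, $1\le q\le\infty$, $1/p+1/q=1$ (with $1/\infty=0$). For $x\in\mathbb{K}^n$ the cone norm is $\|x\|=(|x_1|,\ldots,|x_n|)\in\mathbb{R}^n$; $\preceq$ is the coordinatewise order $\le$ on $\mathbb{R}^n$. For $x\in\mathbb{K}^n$ and $y\in\mathbb{R}^n$ with no zero components, $\frac{x}{y}=\big(\frac{|x_1|}{y_1},\ldots,\frac{|x_n|}{y_n}\big)$. Let $d(x)=(d_1(x),\ldots,d_n(x))$ with $d_i(x)=\min_{j\ne i}|x_i-x_j|$. $\mathcal{D}$ is the set of vectors in $\mathbb{K}^n$ with pairwise distinct components. If $C_0$ is the leading coefficient of $f$, the Weierstrass correction $W_f\colon\mathcal{D}\to\mathbb{K}^n$ is $W_f(x)=(W_1(x),\ldots,W_n(x))$ with $W_i(x)=\frac{f(x_i)}{C_0\prod_{j\ne i}(x_i-x_j)}$, and $E_f\colon\mathcal{D}\to\mathbb{R}_+$ is $E_f(x)=\big\|\frac{W_f(x)}{d(x)}\big\|_p$. The Dochev-Byrnev iteration function $\mathcal{F}=(\mathcal{F}_1,\ldots,\mathcal{F}_n)\colon\mathcal{D}\to\mathbb{K}^n$ is $$\mathcal{F}_i(x)=x_i-\frac{f(x_i)}{g'(x_i)}\left(2-\frac{f'(x_i)}{g'(x_i)}+\frac12\,\frac{f(x_i)}{g'(x_i)}\,\frac{g''(x_i)}{g'(x_i)}\right),\qquad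 g(z)=C_0\prod_{i=1}^n(z-x_i);$$ it coincides with the Prešić-Tanabe iteration function, i.e. $\mathcal{F}_i(x)=x_i-W_i(x)\Big(1-\sum_{j\ne i}\frac{W_j(x)}{x_i-x_j}\Big)$. A vector $\xi\in\mathbb{K}^n$ is a root vector of $f$ if $f(z)=C_0\prod_{i=1}^n(z-\xi_i)$. For $\rho\in\mathbb{R}_+^n$, $\overline{U}(x^{(0)},\rho)=\{x\in\mathbb{K}^n:\|x-x^{(0)}\|\preceq\rho\}$. Convention: $0^0=1$. "Well-defined" means that $x^{(k)}\in\mathcal{D}$ for all $k$. *)

theory Defs
  imports "HOL-Analysis.Analysis" "HOL-Computational_Algebra.Polynomial"
begin

text \<open>
  A field with an absolute value that is complete for the induced metric. In contrast to
  \<^class>\<open>real_normed_field\<close>, no real scalar multiplication is required, so that non-Archimedean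
  fields, fields of positive characteristic and the trivial absolute value are included.
  Nonnegativity, definiteness and the triangle inequality are part of \<^class>\<open>metric_space\<close>
  via the axiom \<open>dist_absval\<close>; see the lemmas below.
\<close>

class complete_normed_field = field + complete_space +
  fixes absval :: "'a \<Rightarrow> real"
  assumes dist_absval: "dist x y = absval (x - y)"
    and absval_mult: "absval (x * y) = absval x * absval y"

lemma absval_nonneg: "absval x \<ge> 0"
  for x :: "'k::complete_normed_field"
  using dist_absval[of x 0] zero_le_dist[of x 0] by simp

lemma absval_eq_0_iff: "absval x = 0 \<longleftrightarrow> x = 0"
  for x :: "'k::complete_normed_field"
  using dist_absval[of x 0] by (metis diff_0_right dist_eq_0_iff)

lemma absval_triangle: "absval (x + y) \<le> absval x + absval y"
  for x y :: "'k::complete_normed_field"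
proof -
  have "dist x (- y) \<le> dist x 0 + dist 0 (- y)" by (rule dist_triangle)
  then show ?thesis by (simp add: dist_absval)
qed

instantiation real :: complete_normed_field
begin

definition absval_real :: "real \<Rightarrow> real" where "absval_real x = \<bar>x\<bar>"

instance by standard (simp_all add: absval_real_def dist_real_def abs_mult)

end

instantiation complex :: complete_normed_field
begin

definition absval_complex :: "complex \<Rightarrow> real" where "absval_complex z = cmod z"

instance by standard (simp_all add: absval_complex_def dist_norm norm_mult)

end

text \<open>Vectors in \<open>K\<^sup>n\<close> have type \<open>'k ^ 'n\<close> with \<open>n = CARD('n)\<close>; the order \<open>\<le>\<close> on
  \<^typ>\<open>real ^ 'n\<close> is the coordinatewise one.\<close>

definition lp_norm :: "ereal \<Rightarrow> real ^ 'n::finite \<Rightarrow> real" where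
  "lp_norm p x =
     (if p = \<infinity> then Max (range (\<lambda>i. \<bar>x $ i\<bar>))
      else (\<Sum>i\<in>UNIV. \<bar>x $ i\<bar> powr real_of_ereal p) powr (1 / real_of_ereal p))"

definition cone_norm :: "'k::complete_normed_field ^ 'n::finite \<Rightarrow> real ^ 'n" where
  "cone_norm x = (\<chi> i. absval (x $ i))"

definition cone_cball ::
    "'k::complete_normed_field ^ 'n::finite \<Rightarrow> real ^ 'n \<Rightarrow> ('k ^ 'n) set" where
  "cone_cball c \<rho> = {x. cone_norm (x - c) \<le> \<rho>}"

definition cone_quotient ::
    "'k::complete_normed_field ^ 'n::finite \<Rightarrow> real ^ 'n \<Rightarrow> real ^ 'n" where
  "cone_quotient x y = (\<chi> i. absval (x $ i) / y $ i)"

definition distinct_vecs :: "('k ^ 'n::finite) set" where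
  "distinct_vecs = {x. inj (\<lambda>i. x $ i)}"

definition separation :: "'k::complete_normed_field ^ 'n::finite \<Rightarrow> real ^ 'n" where
  "separation x = (\<chi> i. Min ((\<lambda>j. absval (x $ i - x $ j)) ` (UNIV - {i})))"

definition weierstrass :: "'k::field poly \<Rightarrow> 'k ^ 'n::finite \<Rightarrow> 'k ^ 'n" where
  "weierstrass f x =
     (\<chi> i. poly f (x $ i) / (lead_coeff f * (\<Prod>j\<in>UNIV - {i}. x $ i - x $ j)))"

definition weierstrass_E ::
    "ereal \<Rightarrow> 'k::complete_normed_field poly \<Rightarrow> 'k ^ 'n::finite \<Rightarrow> real" where
  "weierstrass_E p f x = lp_norm p (cone_quotient (weierstrass f x) (separation x))"

definition monic_from_roots :: "'k::field ^ 'n::finite \<Rightarrow> 'k poly" where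
  "monic_from_roots x = (\<Prod>i\<in>UNIV. [:- (x $ i), 1:])"

definition root_vector :: "'k::field poly \<Rightarrow> 'k ^ 'n::finite \<Rightarrow> bool" where
  "root_vector f \<xi> \<longleftrightarrow> f = smult (lead_coeff f) (monic_from_roots \<xi>)"

text \<open>
  The polynomial \<open>\<one>/\<two> g''\<close> occurring in the Dochev-Byrnev iteration function. The factor
  one half is cancelled in the coefficients, \<open>k (k - 1) / 2 = k choose 2\<close>, so that the
  expression also makes sense in characteristic 2, where \<open>1 / 2\<close> does not exist. In every
  other characteristic it is literally one half of the second derivative.
\<close>

definition half_pderiv2 :: "'k::field poly \<Rightarrow> 'k poly" where
  "half_pderiv2 g = (\<Sum>k\<in>{2..degree g}. monom (of_nat (k choose 2) * coeff g k) (k - 2))"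

lemma coeff_half_pderiv2:
  "coeff (half_pderiv2 g) m = of_nat ((m + 2) choose 2) * coeff g (m + 2)"
proof -
  have "coeff (half_pderiv2 g) m =
      (\<Sum>k\<in>{2..degree g}. if k = m + 2 then of_nat (k choose 2) * coeff g k else 0)"
    unfolding half_pderiv2_def coeff_sum coeff_monom
    by (intro sum.cong) auto
  also have "\<dots> = of_nat ((m + 2) choose 2) * coeff g (m + 2)"
    by (auto simp: coeff_eq_0)
  finally show ?thesis .
qed

lemma smult_2_half_pderiv2: "smult 2 (half_pderiv2 g) = pderiv (pderiv g)"
proof (rule poly_eqI)
  fix m
  have "2 * ((m + 2) choose 2) = (m + 2) * (m + 1)"
    by (simp add: choose_two)
  then have eq: "(2::'a) * of_nat ((m + 2) choose 2) = of_nat ((m + 2) * (m + 1))"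
    by (metis of_nat_mult of_nat_numeral)
  have "coeff (smult 2 (half_pderiv2 g)) m =
      2 * of_nat ((m + 2) choose 2) * coeff g (m + 2)"
    by (simp only: coeff_smult coeff_half_pderiv2 mult.assoc)
  also have "\<dots> = coeff (pderiv (pderiv g)) m"
    unfolding eq by (simp add: coeff_pderiv algebra_simps)
  finally show "coeff (smult 2 (half_pderiv2 g)) m = coeff (pderiv (pderiv g)) m" .
qed

lemma half_pderiv2_smult: "half_pderiv2 (smult c g) = smult c (half_pderiv2 g)"
  by (rule poly_eqI) (simp only: coeff_half_pderiv2 coeff_smult mult.left_commute)

lemma half_pderiv2_diff: "half_pderiv2 (g - h) = half_pderiv2 g - half_pderiv2 h"
  by (rule poly_eqI) (simp only: coeff_half_pderiv2 coeff_diff right_diff_distrib)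

lemma half_pderiv2_pCons_0: "half_pderiv2 (pCons 0 h) = pderiv h + pCons 0 (half_pderiv2 h)"
proof (rule poly_eqI)
  fix m
  have "coeff (half_pderiv2 (pCons 0 h)) m = of_nat ((m + 2) choose 2) * coeff h (m + 1)"
    by (simp only: coeff_half_pderiv2) simp
  also have "(m + 2) choose 2 = (m + 1) + ((m + 1) choose 2)"
    by (simp add: numeral_2_eq_2)
  also have "of_nat \<dots> * coeff h (m + 1) = coeff (pderiv h + pCons 0 (half_pderiv2 h)) m"
    by (cases m) (simp_all add: coeff_pderiv coeff_half_pderiv2 distrib_right binomial_eq_0
        del: binomial_Suc_Suc)
  finally show "coeff (half_pderiv2 (pCons 0 h)) m =
      coeff (pderiv h + pCons 0 (half_pderiv2 h)) m" .
qed

lemma poly_half_pderiv2_linear_factor: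
  "poly (half_pderiv2 ([:- c, 1:] * h)) c = poly (pderiv h) c"
proof -
  have "[:- c, 1:] * h = pCons 0 h - smult c h" by simp
  then show ?thesis
    by (simp only: half_pderiv2_diff half_pderiv2_smult half_pderiv2_pCons_0) simp
qed

definition dochev_byrnev :: "'k::field poly \<Rightarrow> 'k ^ 'n::finite \<Rightarrow> 'k ^ 'n" where
  "dochev_byrnev f x =
     (let g = smult (lead_coeff f) (monic_from_roots x)
      in \<chi> i. x $ i - poly f (x $ i) / poly (pderiv g) (x $ i) *
           (2 - poly (pderiv f) (x $ i) / poly (pderiv g) (x $ i)
              + poly f (x $ i) / poly (pderiv g) (x $ i)
                * (poly (half_pderiv2 g) (x $ i) / poly (pderiv g) (x $ i))))"

lemma dochev_byrnev_char_not_2: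
  fixes x :: "'k::field ^ 'n::finite"
  assumes "(2::'k) \<noteq> 0"
  shows "dochev_byrnev f x =
     (let g = smult (lead_coeff f) (monic_from_roots x)
      in \<chi> i. x $ i - poly f (x $ i) / poly (pderiv g) (x $ i) *
           (2 - poly (pderiv f) (x $ i) / poly (pderiv g) (x $ i)
              + 1 / 2 * (poly f (x $ i) / poly (pderiv g) (x $ i))
                * (poly (pderiv (pderiv g)) (x $ i) / poly (pderiv g) (x $ i))))"
proof -
  have "poly (half_pderiv2 g) z = poly (pderiv (pderiv g)) z / 2" for g :: "'k poly" and z
    using assms by (simp flip: smult_2_half_pderiv2)
  then show ?thesis by (simp only: dochev_byrnev_def Let_def) (simp add: mult_ac)
qed

text \<open>In every characteristic, the Dochev-Byrnev iteration function coincides with the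
  Presic-Tanabe iteration function on \<^const>\<open>distinct_vecs\<close>.\<close>

lemma dochev_byrnev_eq_presic_tanabe:
  fixes f :: "'k::field poly" and x :: "'k ^ 'n::finite"
  assumes deg: "degree f = CARD('n)" and x: "x \<in> distinct_vecs"
  shows "dochev_byrnev f x =
    (\<chi> i. x $ i - weierstrass f x $ i *
       (1 - (\<Sum>j\<in>UNIV - {i}. weierstrass f x $ j / (x $ i - x $ j))))"
proof -
  define c where "c = lead_coeff f"
  define P where "P I = (\<Prod>j\<in>I. [:- (x $ j), 1:])" for I
  define D where "D i = (\<Prod>j\<in>UNIV - {i}. x $ i - x $ j)" for i
  define W where "W i = weierstrass f x $ i" for i
  define g where "g = smult c (monic_from_roots x)"
  have neq: "x $ i - x $ j \<noteq> 0" if "i \<noteq> j" for i j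
    using x that by (auto simp: distinct_vecs_def inj_def)
  have c0: "c \<noteq> 0" using deg by (metis c_def degree_0 leading_coeff_0_iff zero_less_card_finite less_irrefl)
  have D0: "D i \<noteq> 0" for i unfolding D_def using neq by auto
  have W: "poly f (x $ i) = c * D i * W i" for i
    using c0 D0[of i] by (simp add: W_def weierstrass_def D_def c_def)
  have P_split: "P I = [:- (x $ i), 1:] * P (I - {i})" if "i \<in> I" for i I
    unfolding P_def using that by (intro prod.remove) auto
  have P_poly: "poly (P I) z = (\<Prod>j\<in>I. z - x $ j)" for I z
    by (simp add: P_def poly_prod)
  have P_lin: "poly (pderiv (P I)) (x $ i) = poly (P (I - {i})) (x $ i)" if "i \<in> I" for i I
    unfolding P_split[OF that] pderiv_mult by (simp add: pderiv_pCons)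
  have P_drop: "poly (P (UNIV - {i} - {j})) (x $ i) = D i / (x $ i - x $ j)" if "j \<noteq> i" for i j
  proof -
    have "D i = (x $ i - x $ j) * poly (P (UNIV - {i} - {j})) (x $ i)"
      unfolding D_def P_poly using that by (intro prod.remove) auto
    then show ?thesis using neq[of i j] that by simp
  qed
  have g: "g = smult c (P UNIV)" by (simp add: g_def monic_from_roots_def P_def)
  have g1: "poly (pderiv g) (x $ i) = c * D i" for i
    by (simp add: g pderiv_smult P_lin P_poly D_def)
  define S where "S i = (\<Sum>j\<in>UNIV - {i}. 1 / (x $ i - x $ j))" for i
  have P1: "poly (pderiv (P (UNIV - {i}))) (x $ i) = D i * S i" for i
  proof -
    have "poly (pderiv (P (UNIV - {i}))) (x $ i)
        = (\<Sum>j\<in>UNIV - {i}. poly (P (UNIV - {i} - {j})) (x $ i))"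
      by (simp add: P_def pderiv_prod poly_sum pderiv_pCons)
    also have "\<dots> = D i * S i"
      unfolding S_def sum_distrib_left by (intro sum.cong) (auto simp: P_drop)
    finally show ?thesis .
  qed
  have g2: "poly (half_pderiv2 g) (x $ i) = c * D i * S i" for i
  proof -
    have "poly (half_pderiv2 g) (x $ i)
        = c * poly (half_pderiv2 ([:- (x $ i), 1:] * P (UNIV - {i}))) (x $ i)"
      by (simp only: g half_pderiv2_smult P_split[OF UNIV_I, of i] poly_smult)
    then show ?thesis by (simp only: poly_half_pderiv2_linear_factor P1 mult.assoc)
  qed
  define L where "L = smult c (\<Sum>j\<in>UNIV. smult (W j) (P (UNIV - {j})))"
  have deg_P: "degree (P I) = card I" for I
    by (simp add: P_def degree_prod_eq_sum_degree)
  have lead_P: "lead_coeff (P I) = 1" for I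
    unfolding P_def lead_coeff_prod by simp
  have deg_L: "degree L < CARD('n)"
  proof -
    have "degree L \<le> CARD('n) - 1"
      unfolding L_def
      by (intro order.trans[OF degree_smult_le] degree_sum_le)
        (auto intro!: order.trans[OF degree_smult_le] simp: deg_P card_Diff_singleton)
    then show ?thesis by (meson le_less_trans diff_less zero_less_one zero_less_card_finite)
  qed
  have poly_L: "poly L (x $ i) = c * W i * D i" for i
  proof -
    have "poly (P (UNIV - {j})) (x $ i) = (if j = i then D i else 0)" for j
      by (auto simp: P_poly D_def)
    then show ?thesis
      by (simp add: L_def poly_sum if_distrib[of "(*) _"] mult.assoc cong: if_cong)
  qed
  have deg_g: "degree g = CARD('n)" and lead_g: "lead_coeff g = c"
    using c0 lead_P[of UNIV] by (simp_all add: g deg_P)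
  have poly_g: "poly g (x $ i) = 0" for i by (auto simp: g P_poly)
  have f: "f = g + L"
  proof -
    have "degree (f - g) < CARD('n)"
    proof -
      have "degree (f - g) \<le> CARD('n)" using deg deg_g by (intro degree_diff_le) auto
      moreover have "coeff (f - g) CARD('n) = 0"
        using deg deg_g lead_g by (simp add: c_def)
      ultimately show ?thesis
        by (metis degree_0 le_neq_implies_less leading_coeff_0_iff zero_less_card_finite)
    qed
    moreover have "card (range (\<lambda>i. x $ i)) = CARD('n)"
      using x by (intro card_image) (simp add: distinct_vecs_def)
    ultimately have "f - g = L"
      using deg_L by (intro poly_eqI_degree[where A = "range (\<lambda>i. x $ i)"])
        (auto simp: poly_L W poly_g)
    then show ?thesis by (simp add: algebra_simps)
  qed
  have pderiv_sum: "pderiv (\<Sum>j\<in>A. h j) = (\<Sum>j\<in>A. pderiv (h j))"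
    for h :: "'n \<Rightarrow> 'k poly" and A
    by (induct A rule: infinite_finite_induct) (simp_all add: pderiv_add)
  have f1: "poly (pderiv f) (x $ i) =
      c * D i * (1 + W i * S i + (\<Sum>j\<in>UNIV - {i}. W j / (x $ i - x $ j)))" for i
  proof -
    have "poly (pderiv L) (x $ i)
        = c * (\<Sum>j\<in>UNIV. W j * poly (pderiv (P (UNIV - {j}))) (x $ i))"
      by (simp add: L_def pderiv_smult pderiv_sum poly_sum)
    also have "(\<Sum>j\<in>UNIV. W j * poly (pderiv (P (UNIV - {j}))) (x $ i))
        = W i * (D i * S i)
          + (\<Sum>j\<in>UNIV - {i}. W j * poly (pderiv (P (UNIV - {j}))) (x $ i))"
      by (subst sum.remove[of _ i]) (auto simp: P1)
    also have "(\<Sum>j\<in>UNIV - {i}. W j * poly (pderiv (P (UNIV - {j}))) (x $ i))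
        = D i * (\<Sum>j\<in>UNIV - {i}. W j / (x $ i - x $ j))"
      unfolding sum_distrib_left
    proof (intro sum.cong refl)
      fix j assume j: "j \<in> UNIV - {i}"
      have "poly (pderiv (P (UNIV - {j}))) (x $ i) = poly (P (UNIV - {j} - {i})) (x $ i)"
        using j by (intro P_lin) auto
      also have "UNIV - {j} - {i} = UNIV - {i} - {j}" by auto
      finally show "W j * poly (pderiv (P (UNIV - {j}))) (x $ i)
          = D i * (W j / (x $ i - x $ j))"
        using j by (simp add: P_drop)
    qed
    finally show ?thesis by (simp add: f pderiv_add g1 algebra_simps)
  qed
  show ?thesis
  proof (subst vec_eq_iff, rule allI)
    fix i
    define T where "T = (\<Sum>j\<in>UNIV - {i}. W j / (x $ i - x $ j))"
    have nz: "c * D i \<noteq> 0" using c0 D0 by simp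
    have q0: "poly f (x $ i) / poly (pderiv g) (x $ i) = W i"
      unfolding W g1 using nz by simp
    have q1: "poly (pderiv f) (x $ i) / poly (pderiv g) (x $ i) = 1 + W i * S i + T"
      unfolding f1 g1 T_def by (rule nonzero_mult_div_cancel_left[OF nz])
    have q2: "poly (half_pderiv2 g) (x $ i) / poly (pderiv g) (x $ i) = S i"
      unfolding g2 g1 by (rule nonzero_mult_div_cancel_left[OF nz])
    have "dochev_byrnev f x $ i = x $ i - W i * (2 - (1 + W i * S i + T) + W i * S i)"
      unfolding dochev_byrnev_def c_def[symmetric] g_def[symmetric] Let_def vec_lambda_beta q0 q1 q2 ..
    then show "dochev_byrnev f x $ i = (\<chi> i. x $ i - weierstrass f x $ i *
       (1 - (\<Sum>j\<in>UNIV - {i}. weierstrass f x $ j / (x $ i - x $ j)))) $ i"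
      by (simp add: T_def W_def)
  qed
qed

text \<open>Convergence of order (at least) three, in the usual sense of Q-order. All norms
  \<open>\<parallel>\<cdot>\<parallel>\<^sub>p\<close> on \<open>K\<^sup>n\<close> are equivalent to the product metric used here, so the notion
  does not depend on the choice of the norm.\<close>

definition converges_cubically :: "(nat \<Rightarrow> 'a::metric_space) \<Rightarrow> 'a \<Rightarrow> bool" where
  "converges_cubically x \<xi> \<longleftrightarrow>
     x \<longlonglongrightarrow> \<xi> \<and> (\<exists>C. \<forall>k. dist (x (Suc k)) \<xi> \<le> C * dist (x k) \<xi> ^ 3)"

end

theory Submission
  imports Defs
begin

text \<open>
  One step from \<open>x\<close> to \<open>x'\<close> moves each component by at most \<open>\<gamma>(E) |W\<^sub>i|\<close>, so by Hoelder's inequality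
  the separation shrinks by at most the factor \<open>\<psi>(E)\<close>. Inserting \<open>x'\<^sub>i\<close> into the Lagrange form
  \<open>f(z) = C\<^sub>0 \<Prod>\<^bsub>j\<noteq>i\<^esub> (z - x\<^sub>j) (W\<^sub>i + (z - x\<^sub>i) (1 + \<Sum>\<^bsub>j\<noteq>i\<^esub> W\<^sub>j / (z - x\<^sub>j)))\<close> makes the terms of first order
  in \<open>W\<close> cancel and gives \<open>|W\<^sub>i(x')| \<le> \<beta>(E) |W\<^sub>i(x)|\<close>. Hence \<open>E(x') \<le> \<phi>(E) E\<close>. Since
  \<open>\<phi>(\<mu> t) \<le> \<mu>\<^sup>2 \<phi>(t)\<close> for \<open>0 \<le> \<mu> \<le> 1\<close>, and likewise for \<open>\<beta>\<close>, this gives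
  \<open>\<phi>(E\<^sub>k) \<le> \<phi>(E\<^sub>0)^(3^k)\<close>, and the steps are dominated by a geometric series with ratio \<open>\<beta>(E\<^sub>k) < 1\<close>.
  Finally, \<open>\<phi>(E) < 1\<close> says exactly that \<open>b E \<gamma>(E) / (1 - \<beta>(E)) < 1\<close>, which separates the disks.
\<close>

subsection \<open>Power means and the \<open>p\<close>-norm\<close>

text \<open>The arithmetic-geometric mean inequality, from \<open>u \<le> exp (u - 1)\<close> at
  \<open>u = y i / A\<close>: the exponents add up to zero. In the step estimate it turns a bound on
  a sum into the power with exponent \<open>n - 1\<close> in \<open>\<beta>\<close>.\<close>

lemma prod_le_mean_power:
  fixes y :: "'a \<Rightarrow> real"
  assumes "finite S" "S \<noteq> {}" and pos: "\<And>i. i \<in> S \<Longrightarrow> y i > 0"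
  shows "prod y S \<le> (sum y S / real (card S)) ^ card S"
proof -
  define A where "A = sum y S / real (card S)"
  have card: "real (card S) > 0" using assms(1,2) by (simp add: card_gt_0_iff)
  have "sum y S > 0" using assms by (simp add: sum_pos)
  then have A: "A > 0" using card by (simp add: A_def)
  have "prod (\<lambda>i. y i / A) S \<le> prod (\<lambda>i. exp (y i / A - 1)) S"
  proof (intro prod_mono conjI)
    fix i assume "i \<in> S"
    then show "0 \<le> y i / A" using pos[of i] A by simp
    show "y i / A \<le> exp (y i / A - 1)" using exp_ge_add_one_self[of "y i / A - 1"] by simp
  qed
  also have "\<dots> = exp (\<Sum>i\<in>S. y i / A - 1)"
    using assms(1) by (simp add: exp_sum)
  also have "(\<Sum>i\<in>S. y i / A - 1) = sum y S / A - real (card S)"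
    by (simp add: sum_subtractf sum_divide_distrib)
  also have "\<dots> = 0" using \<open>sum y S > 0\<close> card by (simp add: A_def)
  finally have "prod y S / A ^ card S \<le> 1"
    by (simp add: prod_dividef)
  then show ?thesis using A by (simp add: A_def[symmetric] divide_le_eq)
qed

text \<open>Hoelder's inequality against the all-ones vector, obtained from Jensen's inequality for
  \<open>u powr r\<close>. Zero terms are dropped first, so that convexity is applied to positive
  arguments only; \<open>1 - 1 / r \<ge> 0\<close> then allows the return from \<open>card T\<close>
  to \<open>card S\<close>.\<close>

lemma sum_le_card_powr_power_mean:
  fixes u :: "'a \<Rightarrow> real"
  assumes S: "finite S" and u: "\<And>i. i \<in> S \<Longrightarrow> u i \<ge> 0" and r: "r \<ge> 1"
  shows "sum u S \<le> real (card S) powr (1 - 1 / r) * (\<Sum>i\<in>S. u i powr r) powr (1 / r)"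
proof -
  define T where "T = {i \<in> S. u i > 0}"
  have T: "finite T" "T \<subseteq> S" using S by (auto simp: T_def)
  have sumT: "sum u S = sum u T"
    using S u by (intro sum.mono_neutral_right) (force simp: T_def)+
  have le: "card T \<le> card S" using T S by (simp add: card_mono)
  show ?thesis
  proof (cases "T = {}")
    case True
    then show ?thesis by (simp add: sumT)
  next
    case False
    define m where "m = real (card T)"
    have m: "m > 0" using False T by (simp add: m_def card_gt_0_iff)
    have sT: "sum u T > 0" using False T by (intro sum_pos) (auto simp: T_def)
    have "(\<Sum>i\<in>T. (1 / m) *\<^sub>R u i) powr r \<le> (\<Sum>i\<in>T. (1 / m) * u i powr r)"
      using convex_on_sum[OF T(1) False powr_convex[OF r], of "\<lambda>_. 1 / m" u] m
      by (simp add: T_def m_def)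
    then have "(sum u T / m) powr r \<le> (\<Sum>i\<in>T. u i powr r) / m"
      by (simp add: sum_divide_distrib[symmetric])
    then have "((sum u T / m) powr r) powr (1 / r) \<le> ((\<Sum>i\<in>T. u i powr r) / m) powr (1 / r)"
      using r by (intro powr_mono2) auto
    then have "sum u T / m \<le> ((\<Sum>i\<in>T. u i powr r) / m) powr (1 / r)"
      using r m sT by (simp add: powr_powr)
    then have "sum u T \<le> m * ((\<Sum>i\<in>T. u i powr r) powr (1 / r) / m powr (1 / r))"
      using m by (simp add: powr_divide sum_nonneg divide_le_eq mult.commute)
    also have "\<dots> = m powr (1 - 1 / r) * (\<Sum>i\<in>T. u i powr r) powr (1 / r)"
      using m by (simp add: powr_diff)
    also have "\<dots> \<le> real (card S) powr (1 - 1 / r) * (\<Sum>i\<in>S. u i powr r) powr (1 / r)"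
      using m r le S T
      by (intro mult_mono powr_mono2 sum_mono2) (auto simp: m_def sum_nonneg)
    finally show ?thesis by (simp add: sumT)
  qed
qed

text \<open>Carries componentwise estimates of the quotients of correction and separation over to
  \<open>E\<close>.\<close>

lemma lp_norm_mono_scaled:
  fixes u v :: "real ^ 'n::finite"
  assumes p: "1 \<le> p" and c: "c \<ge> 0" and uv: "\<And>i. \<bar>u $ i\<bar> \<le> c * \<bar>v $ i\<bar>"
  shows "lp_norm p u \<le> c * lp_norm p v"
proof (cases "p = \<infinity>")
  case True
  have "\<bar>u $ i\<bar> \<le> c * Max (range (\<lambda>i. \<bar>v $ i\<bar>))" for i
    using uv[of i] c by (meson Max_ge finite_class.finite_UNIV finite_imageI mult_left_mono order_trans rangeI)
  then show ?thesis by (simp add: lp_norm_def True)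
next
  case False
  then obtain s where s: "p = ereal s" "s \<ge> 1" using p by (cases p) (auto simp: one_ereal_def)
  have "(\<Sum>i\<in>UNIV. \<bar>u $ i\<bar> powr s) \<le> (\<Sum>i\<in>UNIV. (c * \<bar>v $ i\<bar>) powr s)"
    using s uv by (intro sum_mono powr_mono2) auto
  also have "\<dots> = c powr s * (\<Sum>i\<in>UNIV. \<bar>v $ i\<bar> powr s)"
    using c by (simp add: powr_mult sum_distrib_left)
  finally have "(\<Sum>i\<in>UNIV. \<bar>u $ i\<bar> powr s) powr (1 / s)
      \<le> (c powr s * (\<Sum>i\<in>UNIV. \<bar>v $ i\<bar> powr s)) powr (1 / s)"
    using s by (intro powr_mono2) (auto simp: sum_nonneg)
  also have "\<dots> = c * (\<Sum>i\<in>UNIV. \<bar>v $ i\<bar> powr s) powr (1 / s)"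
    using c s by (simp add: powr_mult sum_nonneg powr_powr)
  finally show ?thesis by (simp add: lp_norm_def s)
qed

lemma component_le_lp_norm:
  fixes v :: "real ^ 'n::finite"
  assumes "1 \<le> p"
  shows "\<bar>v $ i\<bar> \<le> lp_norm p v"
proof (cases "p = \<infinity>")
  case True
  then show ?thesis by (simp add: lp_norm_def)
next
  case False
  then obtain s where s: "p = ereal s" "s \<ge> 1" using assms by (cases p) (auto simp: one_ereal_def)
  have "\<bar>v $ i\<bar> = (\<bar>v $ i\<bar> powr s) powr (1 / s)" using s by (simp add: powr_powr)
  also have "\<dots> \<le> (\<Sum>i\<in>UNIV. \<bar>v $ i\<bar> powr s) powr (1 / s)"
    using s by (intro powr_mono2 member_le_sum) auto
  finally show ?thesis by (simp add: lp_norm_def s)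
qed

text \<open>Hoelder's inequality against the indicator of \<open>S\<close>. The sets
  \<open>UNIV - {i}\<close> and \<open>{i, j}\<close> produce the constants \<open>a\<close> and
  \<open>b\<close>. The exponent is read off from \<open>1 / q\<close> as an extended real, so
  \<open>q = \<infinity>\<close> is included.\<close>

lemma sum_le_lp_norm:
  fixes v :: "real ^ 'n::finite" and q :: ereal
  assumes p: "1 \<le> p" and pq: "1 / p + 1 / q = 1"
  shows "(\<Sum>i\<in>S. \<bar>v $ i\<bar>) \<le> real (card S) powr real_of_ereal (1 / q) * lp_norm p v"
proof (cases "p = \<infinity>")
  case True
  then have "1 / q = 1" using pq by simp
  moreover have "(\<Sum>i\<in>S. \<bar>v $ i\<bar>) \<le> (\<Sum>i\<in>S. lp_norm p v)"
    by (intro sum_mono component_le_lp_norm p)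
  ultimately show ?thesis by simp
next
  case False
  then obtain s where s: "p = ereal s" "s \<ge> 1" using p by (cases p) (auto simp: one_ereal_def)
  have "1 / p = ereal (1 / s)" using s by (simp add: one_ereal_def)
  then have "real_of_ereal (1 / q) = 1 - 1 / s"
    using pq by (cases "1 / q") (auto simp: one_ereal_def)
  moreover have "(\<Sum>i\<in>S. \<bar>v $ i\<bar>)
      \<le> real (card S) powr (1 - 1 / s) * (\<Sum>i\<in>S. \<bar>v $ i\<bar> powr s) powr (1 / s)"
    using s by (intro sum_le_card_powr_power_mean) auto
  moreover have "(\<Sum>i\<in>S. \<bar>v $ i\<bar> powr s) powr (1 / s)
      \<le> (\<Sum>i\<in>UNIV. \<bar>v $ i\<bar> powr s) powr (1 / s)"
    using s by (intro powr_mono2 sum_mono2) (auto simp: sum_nonneg)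
  ultimately show ?thesis
    by (simp add: lp_norm_def s) (meson mult_left_mono order_trans powr_ge_zero)
qed

subsection \<open>Absolute values\<close>

lemma absval_zero [simp]: "absval (0 :: 'k::complete_normed_field) = 0"
  by (simp add: absval_eq_0_iff)

lemma absval_pos_iff: "0 < absval x \<longleftrightarrow> x \<noteq> 0" for x :: "'k::complete_normed_field"
  using absval_nonneg[of x] absval_eq_0_iff[of x] by linarith

lemma absval_one [simp]: "absval (1 :: 'k::complete_normed_field) = 1"
  using absval_mult[of "1 :: 'k" 1] absval_pos_iff[of "1 :: 'k"] by simp

lemma absval_minus [simp]: "absval (- x) = absval x" for x :: "'k::complete_normed_field"
  using dist_commute[of x 0] by (simp add: dist_absval)

lemma absval_minus_commute: "absval (x - y) = absval (y - x)" for x y :: "'k::complete_normed_field"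
  by (metis absval_minus minus_diff_eq)

lemma absval_divide: "absval (x / y) = absval x / absval y" for x y :: "'k::complete_normed_field"
proof (cases "y = 0")
  case False
  then have "absval (x / y) * absval y = absval x" by (simp flip: absval_mult)
  then show ?thesis using False by (simp add: field_simps absval_eq_0_iff)
qed simp

lemma absval_prod: "absval (prod g S) = (\<Prod>i\<in>S. absval (g i))"
  for g :: "'i \<Rightarrow> 'k::complete_normed_field"
  by (induction S rule: infinite_finite_induct) (simp_all add: absval_mult)

lemma absval_sum_le: "absval (sum g S) \<le> (\<Sum>i\<in>S. absval (g i))"
  for g :: "'i \<Rightarrow> 'k::complete_normed_field"
proof (induction S rule: infinite_finite_induct)
  case (insert i S)
  then show ?case using absval_triangle[of "g i" "sum g S"] by simp
qed simp_all

lemma absval_diff_triangle: "absval (x - y) \<le> absval x + absval y"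
  for x y :: "'k::complete_normed_field"
  using absval_triangle[of x "- y"] by simp

lemma absval_diff_ge: "absval x - absval y \<le> absval (x + y)"
  for x y :: "'k::complete_normed_field"
  using absval_triangle[of "x + y" "- y"] by simp

section \<open>Limits with respect to the absolute value\<close>

lemma absval_tendsto_iff:
  fixes y :: "nat \<Rightarrow> 'k::complete_normed_field"
  shows "y \<longlonglongrightarrow> l \<longleftrightarrow> (\<lambda>k. absval (y k - l)) \<longlonglongrightarrow> 0"
  by (simp add: tendsto_dist_iff[of y] dist_absval)

lemma absval_tendstoI:
  fixes y :: "nat \<Rightarrow> 'k::complete_normed_field"
  assumes "h \<longlonglongrightarrow> 0" "\<And>k. absval (y k - l) \<le> h k"
  shows "y \<longlonglongrightarrow> l"
proof (rule iffD2[OF absval_tendsto_iff])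
  show "(\<lambda>k. absval (y k - l)) \<longlonglongrightarrow> 0"
    by (rule tendsto_sandwich[OF _ _ tendsto_const assms(1)]) (auto simp: absval_nonneg assms(2))
qed

lemma absval_tendsto_add:
  fixes y z :: "nat \<Rightarrow> 'k::complete_normed_field"
  assumes "y \<longlonglongrightarrow> l" "z \<longlonglongrightarrow> m"
  shows "(\<lambda>k. y k + z k) \<longlonglongrightarrow> l + m"
proof -
  have "(\<lambda>k. absval (y k - l) + absval (z k - m)) \<longlonglongrightarrow> 0"
    using assms[THEN absval_tendsto_iff[THEN iffD1]] by (intro tendsto_add_zero)
  moreover have "absval (y k + z k - (l + m)) \<le> absval (y k - l) + absval (z k - m)" for k
    using absval_triangle[of "y k - l" "z k - m"] by (simp add: algebra_simps)
  ultimately show ?thesis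
    by (simp add: absval_tendstoI)
qed

text \<open>Expanding \<open>y k * z k\<close> around \<open>l * m\<close> leaves three terms, each
  with a factor that tends to zero.\<close>

lemma absval_tendsto_mult:
  fixes y z :: "nat \<Rightarrow> 'k::complete_normed_field"
  assumes "y \<longlonglongrightarrow> l" "z \<longlonglongrightarrow> m"
  shows "(\<lambda>k. y k * z k) \<longlonglongrightarrow> l * m"
proof -
  let ?e = "\<lambda>k. absval (y k - l)" and ?h = "\<lambda>k. absval (z k - m)"
  have "(\<lambda>k. ?e k * ?h k + absval l * ?h k + ?e k * absval m) \<longlonglongrightarrow> 0 * 0 + absval l * 0 + 0 * absval m"
    using assms[THEN absval_tendsto_iff[THEN iffD1]] by (intro tendsto_intros)
  moreover have "absval (y k * z k - l * m) \<le> ?e k * ?h k + absval l * ?h k + ?e k * absval m" for k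
  proof -
    have "y k * z k - l * m = (y k - l) * (z k - m) + l * (z k - m) + (y k - l) * m"
      by (simp add: algebra_simps)
    then show ?thesis
      using absval_triangle[of "(y k - l) * (z k - m) + l * (z k - m)" "(y k - l) * m"]
        absval_triangle[of "(y k - l) * (z k - m)" "l * (z k - m)"]
      by (simp add: absval_mult)
  qed
  ultimately show ?thesis
    by (simp add: absval_tendstoI)
qed

lemma absval_tendsto_sum:
  fixes y :: "'i \<Rightarrow> nat \<Rightarrow> 'k::complete_normed_field"
  assumes "\<And>i. i \<in> S \<Longrightarrow> y i \<longlonglongrightarrow> l i"
  shows "(\<lambda>k. \<Sum>i\<in>S. y i k) \<longlonglongrightarrow> (\<Sum>i\<in>S. l i)"
  using assms
  by (induction S rule: infinite_finite_induct) (auto intro: absval_tendsto_add)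

text \<open>The limit is taken in the coefficients because values do not determine a polynomial
  over a finite field.\<close>

lemma coeff_prod_linear_tendsto:
  fixes y :: "nat \<Rightarrow> 'k::complete_normed_field ^ 'n::finite"
  assumes "y \<longlonglongrightarrow> \<xi>"
  shows "(\<lambda>k. coeff (\<Prod>i\<in>S. [:- (y k $ i), 1:]) m) \<longlonglongrightarrow> coeff (\<Prod>i\<in>S. [:- (\<xi> $ i), 1:]) m"
proof (induction S arbitrary: m rule: infinite_finite_induct)
  case (insert i S)
  have "(\<lambda>k. - 1 * y k $ i) \<longlonglongrightarrow> - 1 * \<xi> $ i"
    using tendsto_vec_nth[OF assms] by (intro absval_tendsto_mult) auto
  then have y: "(\<lambda>k. - (y k $ i)) \<longlonglongrightarrow> - (\<xi> $ i)" by simp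
  show ?case
  proof (cases m)
    case 0
    then show ?thesis
      using insert absval_tendsto_mult[OF y insert.IH[of 0]] by simp
  next
    case (Suc l)
    then show ?thesis
      using insert absval_tendsto_add[OF absval_tendsto_mult[OF y insert.IH[of m]] insert.IH[of l]]
      by simp
  qed
qed simp_all

section \<open>Sequences with geometrically decreasing steps\<close>

text \<open>The steps are summed from \<open>m\<close> to \<open>m + j\<close>. The bound in
  \<open>tail\<close> is the exact partial sum of the geometric series, so the induction closes with
  an equality. It is applied to the tails of each component of the iteration.\<close>

lemma geometric_steps:
  fixes y :: "nat \<Rightarrow> 'a::complete_space"
  assumes r: "0 \<le> r" "r < 1" and steps: "\<And>j. dist (y (Suc j)) (y j) \<le> C * r ^ j"
  shows "\<exists>l. y \<longlonglongrightarrow> l" and "dist (y j) (y 0) \<le> C / (1 - r)"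
    and "y \<longlonglongrightarrow> l \<Longrightarrow> dist (y 0) l \<le> C / (1 - r)"
proof -
  have C: "C \<ge> 0" using order_trans[OF zero_le_dist steps[of 0]] by simp
  have tail: "dist (y (m + j)) (y m) \<le> C / (1 - r) * (r ^ m - r ^ (m + j))" for m j
  proof (induction j)
    case (Suc j)
    have "dist (y (m + Suc j)) (y m) \<le> dist (y (Suc (m + j))) (y (m + j)) + dist (y (m + j)) (y m)"
      by (simp add: dist_triangle)
    also have "\<dots> \<le> C * r ^ (m + j) + C / (1 - r) * (r ^ m - r ^ (m + j))"
      using steps Suc by (intro add_mono)
    also have "\<dots> = C / (1 - r) * (r ^ m - r ^ (m + Suc j))"
    proof -
      have "C = C / (1 - r) * (1 - r)" using r by simp
      then have "C * r ^ (m + j) = C / (1 - r) * (r ^ (m + j) - r ^ (m + Suc j))"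
        by (metis (no_types) add_Suc_right left_diff_distrib mult.assoc mult_1 power_Suc)
      then show ?thesis by (simp add: right_diff_distrib)
    qed
    finally show ?case .
  qed simp
  have tail': "dist (y (m + j)) (y m) \<le> C / (1 - r) * r ^ m" for m j
    using C r by (intro order_trans[OF tail] mult_left_mono) auto
  then show bound: "dist (y j) (y 0) \<le> C / (1 - r)" for j using tail'[of 0 j] by simp
  have "Cauchy y"
    unfolding Cauchy_altdef2
  proof (intro allI impI)
    fix e :: real assume "e > 0"
    have "(\<lambda>m. C / (1 - r) * r ^ m) \<longlonglongrightarrow> C / (1 - r) * 0"
      using r by (intro tendsto_intros) auto
    then have "\<forall>\<^sub>F m in sequentially. C / (1 - r) * r ^ m < e"
      using \<open>e > 0\<close> by (simp add: order_tendstoD)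
    then obtain N where N: "C / (1 - r) * r ^ N < e" by (auto simp: eventually_sequentially)
    show "\<exists>N. \<forall>n\<ge>N. dist (y n) (y N) < e"
      using N tail'[of N] by (metis le_Suc_ex le_less_trans)
  qed
  then show "\<exists>l. y \<longlonglongrightarrow> l" by (simp add: Cauchy_convergent_iff convergent_def)
  show "dist (y 0) l \<le> C / (1 - r)" if "y \<longlonglongrightarrow> l"
  proof (rule tendsto_upperbound)
    show "(\<lambda>j. dist (y 0) (y j)) \<longlonglongrightarrow> dist (y 0) l" using that by (intro tendsto_intros)
  qed (use bound in \<open>auto simp: dist_commute\<close>)
qed

subsection \<open>Weierstrass corrections\<close>

lemma separation_le:
  fixes x :: "'k::complete_normed_field ^ 'n::finite"
  assumes "i \<noteq> j"
  shows "separation x $ i \<le> absval (x $ i - x $ j)"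
  using assms by (auto simp: separation_def intro!: Min_le)

lemma UNIV_minus_singleton_nonempty:
  assumes "CARD('n::finite) \<ge> 2"
  shows "UNIV - {i :: 'n} \<noteq> {}"
proof
  assume "UNIV - {i} = {}"
  then have "(UNIV :: 'n set) \<subseteq> {i}" by blast
  from card_mono[OF _ this] show False using assms by simp
qed

text \<open>Two indices make the set under \<open>Min\<close> nonempty; for the empty set
  \<open>Min\<close> would carry no information.\<close>

lemma le_separation:
  fixes x :: "'k::complete_normed_field ^ 'n::finite"
  assumes "CARD('n) \<ge> 2" and "\<And>j. j \<noteq> i \<Longrightarrow> c \<le> absval (x $ i - x $ j)"
  shows "c \<le> separation x $ i"
proof -
  have "UNIV - {i} \<noteq> {}" using assms(1) by (rule UNIV_minus_singleton_nonempty)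
  then show ?thesis using assms(2) by (auto simp: separation_def)
qed

lemma distinct_vecs_iff: "x \<in> distinct_vecs \<longleftrightarrow> (\<forall>i j. i \<noteq> j \<longrightarrow> x $ i - x $ j \<noteq> 0)"
  for x :: "'k::field ^ 'n::finite"
  by (auto simp: distinct_vecs_def inj_def)

lemma separation_pos:
  fixes x :: "'k::complete_normed_field ^ 'n::finite"
  assumes "x \<in> distinct_vecs" "CARD('n) \<ge> 2"
  shows "separation x $ i > 0"
proof -
  have "UNIV - {i} \<noteq> {}"
    using assms(2) by (rule UNIV_minus_singleton_nonempty)
  then show ?thesis
    using assms(1) by (auto simp: separation_def absval_pos_iff distinct_vecs_iff)
qed

text \<open>Lagrange interpolation: both sides have degree at most \<open>n\<close>, the same
  coefficient at \<open>n\<close>, and equal values at the \<open>n\<close> distinct points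
  \<open>x $ i\<close>. It is an identity of polynomials because the limit is later taken in the
  coefficients.\<close>

lemma weierstrass_decomposition:
  fixes f :: "'k::field poly" and x :: "'k ^ 'n::finite"
  assumes deg: "degree f = CARD('n)" and x: "x \<in> distinct_vecs"
  shows "f = smult (lead_coeff f) (monic_from_roots x
    + (\<Sum>j\<in>UNIV. smult (weierstrass f x $ j) (\<Prod>k\<in>UNIV - {j}. [:- (x $ k), 1:])))"
    (is "f = smult ?c (?P + ?L)")
proof -
  have neq: "x $ i - x $ j \<noteq> 0" if "i \<noteq> j" for i j
    using x that by (simp add: distinct_vecs_iff)
  have c0: "?c \<noteq> 0" using deg by (metis degree_0 leading_coeff_0_iff zero_less_card_finite less_irrefl)
  have P: "degree ?P = CARD('n)" "lead_coeff ?P = 1"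
    unfolding monic_from_roots_def lead_coeff_prod by (simp_all add: degree_prod_eq_sum_degree)
  have degL: "degree ?L \<le> CARD('n) - 1"
    by (intro degree_sum_le)
      (auto intro!: order.trans[OF degree_smult_le] simp: degree_prod_eq_sum_degree card_Diff_singleton)
  then have L: "degree ?L < CARD('n)"
    by (meson le_less_trans diff_less zero_less_one zero_less_card_finite)
  show ?thesis
  proof (rule poly_eqI_degree_lead_coeff[where A = "range (\<lambda>i. x $ i)" and n = "CARD('n)"])
    show "coeff f CARD('n) = coeff (smult ?c (?P + ?L)) CARD('n)"
      using P L deg by (simp add: coeff_eq_0)
    have "card (range (\<lambda>i. x $ i)) = CARD('n)"
      using x by (intro card_image) (simp add: distinct_vecs_def)
    then show "CARD('n) \<le> card (range (\<lambda>i. x $ i))" by simp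
    show "degree (smult ?c (?P + ?L)) \<le> CARD('n)"
      using P L by (intro order.trans[OF degree_smult_le] degree_add_le) auto
  next
    fix z assume "z \<in> range (\<lambda>i. x $ i)"
    then obtain i where z: "z = x $ i" by auto
    have "poly ?P z = 0" by (auto simp: z monic_from_roots_def poly_prod)
    moreover have "poly (smult (weierstrass f x $ j) (\<Prod>k\<in>UNIV - {j}. [:- (x $ k), 1:])) z
        = (if j = i then weierstrass f x $ i * (\<Prod>k\<in>UNIV - {i}. x $ i - x $ k) else 0)" for j
      by (auto simp: z poly_prod)
    moreover have "(\<Prod>k\<in>UNIV - {i}. x $ i - x $ k) \<noteq> 0" using neq by auto
    ultimately show "poly f z = poly (smult ?c (?P + ?L)) z"
      using c0 by (simp add: poly_sum weierstrass_def z)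
  qed (simp add: deg)
qed

text \<open>The product over \<open>j \<noteq> i\<close> is pulled out of the decomposition. Only
  the nodes other than \<open>x $ i\<close> are excluded for \<open>z\<close>, since a component
  with zero correction does not move in the step.\<close>

lemma poly_eq_weierstrass:
  fixes f :: "'k::field poly" and x :: "'k ^ 'n::finite"
  assumes deg: "degree f = CARD('n)" and x: "x \<in> distinct_vecs" and z: "\<And>j. j \<noteq> i \<Longrightarrow> z \<noteq> x $ j"
  shows "poly f z = lead_coeff f * (\<Prod>j\<in>UNIV - {i}. z - x $ j)
    * (weierstrass f x $ i + (z - x $ i) * (1 + (\<Sum>j\<in>UNIV - {i}. weierstrass f x $ j / (z - x $ j))))"
proof -
  let ?W = "\<lambda>j. weierstrass f x $ j" and ?Q = "\<Prod>j\<in>UNIV - {i}. z - x $ j"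
  have "poly f z = lead_coeff f * ((\<Prod>j\<in>UNIV. z - x $ j) + (\<Sum>j\<in>UNIV. ?W j * (\<Prod>k\<in>UNIV - {j}. z - x $ k)))"
    by (subst weierstrass_decomposition[OF deg x]) (simp add: monic_from_roots_def poly_prod poly_sum)
  also have "(\<Prod>j\<in>UNIV. z - x $ j) = (z - x $ i) * ?Q"
    by (intro prod.remove) auto
  also have "(\<Sum>j\<in>UNIV. ?W j * (\<Prod>k\<in>UNIV - {j}. z - x $ k))
      = ?W i * ?Q + (\<Sum>j\<in>UNIV - {i}. ?W j * (\<Prod>k\<in>UNIV - {j}. z - x $ k))"
    by (subst sum.remove[of _ i]) auto
  also have "(\<Sum>j\<in>UNIV - {i}. ?W j * (\<Prod>k\<in>UNIV - {j}. z - x $ k))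
      = ?Q * ((z - x $ i) * (\<Sum>j\<in>UNIV - {i}. ?W j / (z - x $ j)))"
    unfolding sum_distrib_left
  proof (intro sum.cong refl)
    fix j assume j: "j \<in> UNIV - {i}"
    have "(\<Prod>k\<in>UNIV - {j}. z - x $ k) = (z - x $ i) * (\<Prod>k\<in>UNIV - {j} - {i}. z - x $ k)"
      using j by (intro prod.remove) auto
    moreover have "?Q = (z - x $ j) * (\<Prod>k\<in>UNIV - {i} - {j}. z - x $ k)"
      using j by (intro prod.remove) auto
    moreover have "UNIV - {i} - {j} = UNIV - {j} - {i}" by auto
    ultimately show "?W j * (\<Prod>k\<in>UNIV - {j}. z - x $ k) = ?Q * ((z - x $ i) * (?W j / (z - x $ j)))"
      using z[of j] j by simp
  qed
  finally show ?thesis by (simp add: algebra_simps)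
qed

subsection \<open>One step of the iteration\<close>

text \<open>About \<open>a\<close> and \<open>b\<close> only the bounds by one are recorded here.
  Their values as powers enter later, when the Hoelder estimates assumed in \<open>one_step\<close>
  are verified.\<close>

locale dochev_byrnev_majorants =
  fixes n :: nat and a b :: real and \<gamma> \<psi> \<beta> \<phi> :: "real \<Rightarrow> real"
  assumes n: "n \<ge> 2" and a: "a \<ge> 1" and b: "b \<ge> 1"
    and \<gamma>: "\<And>t. \<gamma> t = 1 + a * t"
    and \<psi>: "\<And>t. \<psi> t = 1 - b * t - a * b * t\<^sup>2"
    and \<beta>: "\<And>t. \<beta> t =
          a * t\<^sup>2 * (1 + a * t) * (1 + a + a * t) / ((1 - a * t) * (1 - t - a * t\<^sup>2))
          * (1 + a * t * (1 + a * t) / (real (n - 1) * (1 - b * t - a * b * t\<^sup>2))) ^ (n - 1)"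
    and \<phi>: "\<And>t. \<phi> t = \<beta> t / \<psi> t"
begin

text \<open>The size condition on the initial guess without square roots: for
  \<open>t \<ge> 0\<close>, positivity of \<open>\<psi> t\<close> means that \<open>t\<close> lies
  below the positive root \<open>2 / (b + sqrt (b\<^sup>2 + 4 * a * b))\<close> of
  \<open>\<psi>\<close>.\<close>

definition admissible :: "real \<Rightarrow> bool" where
  "admissible t \<longleftrightarrow> 0 \<le> t \<and> a * t < 1 \<and> 0 < \<psi> t"

lemma \<psi>_eq: "\<psi> t = 1 - b * (t * \<gamma> t)"
  by (simp add: \<psi> \<gamma> algebra_simps power2_eq_square)

lemma \<gamma>_mono: "s \<le> t \<Longrightarrow> \<gamma> s \<le> \<gamma> t"
  using a by (simp add: \<gamma>)

lemma \<gamma>_ge_one: "0 \<le> t \<Longrightarrow> 1 \<le> \<gamma> t"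
  using a by (simp add: \<gamma>)

lemma \<psi>_antimono: "0 \<le> s \<Longrightarrow> s \<le> t \<Longrightarrow> \<psi> t \<le> \<psi> s"
  using a b by (simp add: \<psi>_eq) (intro mult_left_mono mult_mono, auto simp: \<gamma>)

text \<open>Since \<open>b \<ge> 1\<close>, positivity of \<open>\<psi> t\<close> also makes the
  other quadratic denominator of \<open>\<beta>\<close> positive.\<close>

lemma \<psi>_le: "0 \<le> t \<Longrightarrow> \<psi> t \<le> 1 - t - a * t\<^sup>2"
  using mult_right_mono[OF b, of "t * \<gamma> t"] a
  by (simp add: \<psi>_eq) (simp add: \<gamma> algebra_simps power2_eq_square)

lemma admissible_mono: "admissible t \<Longrightarrow> 0 \<le> s \<Longrightarrow> s \<le> t \<Longrightarrow> admissible s"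
  using \<psi>_antimono[of s t] a mult_left_mono[of s t a] unfolding admissible_def by linarith

text \<open>The cofactor of \<open>t\<^sup>2\<close> in \<open>\<beta>\<close>; its monotonicity is what yields \<open>\<beta>(\<mu> t) \<le> \<mu>\<^sup>2 \<beta>(t)\<close>.\<close>

definition step_quotient :: "real \<Rightarrow> real" where
  "step_quotient t = a * (1 + a * t) * (1 + a + a * t) / ((1 - a * t) * (1 - t - a * t\<^sup>2))
          * (1 + a * t * (1 + a * t) / (real (n - 1) * \<psi> t)) ^ (n - 1)"

lemma \<beta>_eq: "\<beta> t = t\<^sup>2 * step_quotient t"
  by (simp add: \<beta> step_quotient_def \<psi>)

lemma step_quotient_nonneg: "admissible t \<Longrightarrow> 0 \<le> step_quotient t"
  unfolding admissible_def step_quotient_def using a \<psi>_le[of t]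
  by (intro mult_nonneg_nonneg divide_nonneg_nonneg zero_le_power add_nonneg_nonneg) auto

text \<open>All numerators increase with the argument, and all denominators decrease and stay
  positive up to \<open>t\<close>.\<close>

lemma step_quotient_mono:
  assumes t: "admissible t" and s: "0 \<le> s" "s \<le> t"
  shows "step_quotient s \<le> step_quotient t"
proof -
  have s': "admissible s" using admissible_mono t s by blast
  have as: "a * s \<le> a * t" "0 \<le> a * s" using a s by simp_all
  have at2: "a * s\<^sup>2 \<le> a * t\<^sup>2" using a s by (intro mult_left_mono power_mono) auto
  have pos: "0 < 1 - a * t" "0 < 1 - t - a * t\<^sup>2" "0 < \<psi> t" "0 < \<psi> s" "0 < real (n - 1)"
    using t s' \<psi>_le[of t] n by (auto simp: admissible_def)
  have psi: "\<psi> t \<le> \<psi> s" using \<psi>_antimono s by blast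
  have A: "a * (1 + a * s) * (1 + a + a * s) \<le> a * (1 + a * t) * (1 + a + a * t)"
    using a as s by (intro mult_mono mult_left_mono) (auto intro!: mult_nonneg_nonneg add_nonneg_nonneg)
  have B: "(1 - a * t) * (1 - t - a * t\<^sup>2) \<le> (1 - a * s) * (1 - s - a * s\<^sup>2)"
    using as at2 pos s by (intro mult_mono) auto
  have C: "a * s * (1 + a * s) / (real (n - 1) * \<psi> s) \<le> a * t * (1 + a * t) / (real (n - 1) * \<psi> t)"
    using as psi pos s a by (intro frac_le mult_mono) auto
  have t0: "0 \<le> t" "0 \<le> a * t" using s a by simp_all
  have "a * (1 + a * s) * (1 + a + a * s) / ((1 - a * s) * (1 - s - a * s\<^sup>2))
      \<le> a * (1 + a * t) * (1 + a + a * t) / ((1 - a * t) * (1 - t - a * t\<^sup>2))"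
    using a t0 pos by (intro frac_le A B) auto
  moreover have "(1 + a * s * (1 + a * s) / (real (n - 1) * \<psi> s)) ^ (n - 1)
      \<le> (1 + a * t * (1 + a * t) / (real (n - 1) * \<psi> t)) ^ (n - 1)"
    using as pos by (intro power_mono add_left_mono C) auto
  ultimately show ?thesis
    unfolding step_quotient_def using a as t0 pos by (rule_tac mult_mono) auto
qed

lemma \<beta>_nonneg: "admissible t \<Longrightarrow> 0 \<le> \<beta> t"
  by (simp add: \<beta>_eq step_quotient_nonneg)

lemma \<phi>_nonneg: "admissible t \<Longrightarrow> 0 \<le> \<phi> t"
  using \<beta>_nonneg[of t] by (simp add: \<phi> admissible_def)

lemma \<beta>_scale: "admissible t \<Longrightarrow> 0 \<le> \<mu> \<Longrightarrow> \<mu> \<le> 1 \<Longrightarrow> \<beta> (\<mu> * t) \<le> \<mu>\<^sup>2 * \<beta> t"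
  unfolding \<beta>_eq power_mult_distrib mult.assoc
  by (intro mult_left_mono step_quotient_mono) (auto simp: admissible_def mult_left_le_one_le)

lemma \<beta>_mono: "admissible t \<Longrightarrow> 0 \<le> s \<Longrightarrow> s \<le> t \<Longrightarrow> \<beta> s \<le> \<beta> t"
  unfolding \<beta>_eq using step_quotient_nonneg[of s] admissible_mono[of t s]
  by (intro mult_mono power_mono step_quotient_mono) (auto)

lemma \<phi>_scale:
  assumes t: "admissible t" and \<mu>: "0 \<le> \<mu>" "\<mu> \<le> 1"
  shows "\<phi> (\<mu> * t) \<le> \<mu>\<^sup>2 * \<phi> t"
proof -
  have st: "0 \<le> \<mu> * t" "\<mu> * t \<le> t" using t \<mu> by (auto simp: admissible_def mult_left_le_one_le)
  have "\<beta> (\<mu> * t) / \<psi> (\<mu> * t) \<le> (\<mu>\<^sup>2 * \<beta> t) / \<psi> t"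
    using \<beta>_scale[OF t \<mu>] \<psi>_antimono[OF st] \<beta>_nonneg[OF t] t
    by (intro frac_le) (auto simp: admissible_def)
  then show ?thesis by (simp add: \<phi>)
qed

lemma \<phi>_mono: "admissible t \<Longrightarrow> 0 \<le> s \<Longrightarrow> s \<le> t \<Longrightarrow> \<phi> s \<le> \<phi> t"
  unfolding \<phi> using \<beta>_nonneg[of t] \<beta>_mono[of t s] \<psi>_antimono[of s t]
  by (intro frac_le) (auto simp: admissible_def)

lemma \<beta>_eq_\<psi>_\<phi>: "admissible t \<Longrightarrow> \<beta> t = \<psi> t * \<phi> t"
  by (simp add: \<phi> admissible_def)

text \<open>For \<open>t > 0\<close> one has \<open>\<beta> t \<le> \<psi> t < 1\<close>. The point
  zero is separate because \<open>\<psi> 0 = 1\<close>; there \<open>\<beta>\<close>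
  vanishes.\<close>

lemma \<beta>_less_one:
  assumes t: "admissible t" and le: "\<phi> t \<le> 1"
  shows "\<beta> t < 1"
proof (cases "t = 0")
  case True
  then show ?thesis by (simp add: \<beta>)
next
  case False
  then have "t > 0" using t by (simp add: admissible_def)
  then have "\<psi> t < 1"
    using \<psi>_le[of t] a by (smt (verit) mult_nonneg_nonneg zero_le_power2)
  moreover have "\<beta> t \<le> \<psi> t"
    using t le by (simp add: \<phi> admissible_def)
  ultimately show ?thesis by simp
qed

text \<open>The norm enters only through \<open>single\<close>, \<open>others\<close> and
  \<open>pair\<close>, so \<open>t\<close> stands for \<open>E\<close> with no reference to
  \<open>p\<close>. The first three conclusions compare distances before and after the step; the
  last one inserts the new point into the interpolation formula.\<close>

lemma one_step:
  fixes f :: "'k::complete_normed_field poly" and x :: "'k ^ 'n::finite"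
  defines "w \<equiv> \<lambda>i. absval (weierstrass f x $ i)" and "d \<equiv> \<lambda>i. separation x $ i"
    and "x' \<equiv> dochev_byrnev f x"
  assumes card: "n = CARD('n)" and deg: "degree f = n" and x: "x \<in> distinct_vecs"
    and t: "admissible t"
    and single: "\<And>i. w i / d i \<le> t"
    and others: "\<And>i. (\<Sum>j\<in>UNIV - {i}. w j / d j) \<le> a * t"
    and pair: "\<And>i j. i \<noteq> j \<Longrightarrow> w i / d i + w j / d j \<le> b * t"
  shows "absval (x' $ i - x $ i) \<le> \<gamma> t * w i" (is "?shift i")
    and "x' \<in> distinct_vecs"
    and "\<psi> t * d i \<le> separation x' $ i"
    and "absval (weierstrass f x' $ i) \<le> \<beta> t * w i"
proof -
  define W where "W i = weierstrass f x $ i" for i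
  define \<sigma> where "\<sigma> i = (\<Sum>j\<in>UNIV - {i}. W j / (x $ i - x $ j))" for i
  define \<kappa> where "\<kappa> = 1 - t - a * t\<^sup>2"
  have deg': "degree f = CARD('n)" using deg card by simp
  have w: "w i = absval (W i)" "0 \<le> w i" for i by (simp_all add: w_def W_def absval_nonneg)
  have d: "0 < d i" for i using separation_pos[OF x] n card by (simp add: d_def)
  have dle: "d i \<le> absval (x $ i - x $ j)" "d j \<le> absval (x $ i - x $ j)" if "i \<noteq> j" for i j
    using separation_le[of i j x] separation_le[of j i x] that
    by (auto simp: d_def absval_minus_commute)
  have dpos: "0 < absval (x $ i - x $ j)" if "i \<noteq> j" for i j
    using dle[OF that] d[of i] by simp
  have tpos: "0 \<le> t" "a * t < 1" "0 < \<psi> t" using t by (auto simp: admissible_def)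
  have \<kappa>: "0 < \<kappa>" "\<kappa> = 1 - t * \<gamma> t"
    using \<psi>_le[of t] tpos by (auto simp: \<kappa>_def \<gamma> algebra_simps power2_eq_square)
  have \<gamma>1: "1 \<le> \<gamma> t" using \<gamma>_ge_one tpos by simp
  have x': "x' $ i - x $ i = - (W i * (1 - \<sigma> i))" for i
    unfolding x'_def dochev_byrnev_eq_presic_tanabe[OF deg' x] by (simp add: W_def \<sigma>_def)
  have quot: "absval (W j / (x $ i - x $ j)) \<le> w j / d j" if "j \<noteq> i" for i j
    using dle[of i j] that d[of j] w(2)[of j] by (auto simp: absval_divide w(1)[symmetric] intro!: frac_le)
  have \<sigma>: "absval (\<sigma> i) \<le> a * t" for i
  proof -
    have "absval (\<sigma> i) \<le> (\<Sum>j\<in>UNIV - {i}. w j / d j)"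
      unfolding \<sigma>_def by (intro order_trans[OF absval_sum_le] sum_mono quot) auto
    then show ?thesis using others[of i] by simp
  qed
  show shift: "?shift i" for i
  proof -
    have "absval (1 - \<sigma> i) \<le> \<gamma> t"
      using absval_diff_triangle[of 1 "\<sigma> i"] \<sigma>[of i] by (simp add: \<gamma>)
    then have "absval (W i) * absval (1 - \<sigma> i) \<le> absval (W i) * \<gamma> t"
      by (intro mult_left_mono absval_nonneg)
    then show ?thesis by (simp add: x' absval_mult w(1) mult.commute)
  qed
  have w_le: "w i \<le> t * d i" for i
    using single[of i] d[of i] by (simp add: pos_divide_le_eq)
  have shift': "absval (x' $ i - x $ i) \<le> t * \<gamma> t * absval (x $ i - x $ j)" if "i \<noteq> j" for i j
  proof -
    have "absval (x' $ i - x $ i) \<le> \<gamma> t * (t * absval (x $ i - x $ j))"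
      using \<gamma>1 tpos w_le[of i] mult_left_mono[OF dle(1)[OF that] tpos(1)]
      by (intro order_trans[OF shift] mult_left_mono) auto
    then show ?thesis by (simp add: mult_ac)
  qed
  \<comment> \<open>Only one of the two points has moved, so the relative shift
    \<open>t * \<gamma> t\<close> of a single component is lost.\<close>
  have mixed: "\<kappa> * absval (x $ i - x $ j) \<le> absval (x' $ i - x $ j)" if "i \<noteq> j" for i j
    using shift'[OF that] absval_diff_ge[of "x $ i - x $ j" "x' $ i - x $ i"]
    by (simp add: \<kappa> algebra_simps)
  \<comment> \<open>Both points move. Bounding the two shifts jointly by \<open>pair\<close> costs
    \<open>b * t * \<gamma> t\<close> instead of \<open>2 * t * \<gamma> t\<close>, which gives the
    factor \<open>\<psi> t\<close>.\<close>
  have both: "\<psi> t * absval (x $ i - x $ j) \<le> absval (x' $ i - x' $ j)" if "i \<noteq> j" for i j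
  proof -
    let ?D = "absval (x $ i - x $ j)"
    have "w i + w j = w i / d i * d i + w j / d j * d j" using d[of i] d[of j] by simp
    also have "\<dots> \<le> w i / d i * ?D + w j / d j * ?D"
      using dle[OF that] w d by (intro add_mono mult_left_mono) (auto simp: less_imp_le)
    also have "\<dots> \<le> b * t * ?D"
      using pair[OF that] mult_right_mono[of "w i / d i + w j / d j" "b * t" ?D]
      by (simp add: absval_nonneg distrib_right)
    finally have "\<gamma> t * (w i + w j) \<le> \<gamma> t * (b * t * ?D)"
      using \<gamma>1 by (intro mult_left_mono) auto
    moreover have "?D - absval ((x' $ i - x $ i) - (x' $ j - x $ j)) \<le> absval (x' $ i - x' $ j)"
      using absval_diff_ge[of "x $ i - x $ j" "(x' $ i - x $ i) - (x' $ j - x $ j)"] by simp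
    moreover have "absval ((x' $ i - x $ i) - (x' $ j - x $ j)) \<le> \<gamma> t * (w i + w j)"
      using absval_diff_triangle[of "x' $ i - x $ i" "x' $ j - x $ j"] shift[of i] shift[of j]
      by (simp add: distrib_left)
    ultimately show ?thesis by (simp add: \<psi>_eq algebra_simps)
  qed
  have pos': "0 < absval (x' $ i - x' $ j)" if "i \<noteq> j" for i j
    using mult_pos_pos[OF tpos(3) dpos[OF that]] both[OF that] by linarith
  then show D': "x' \<in> distinct_vecs" by (simp add: distinct_vecs_iff absval_pos_iff)
  show "\<psi> t * d i \<le> separation x' $ i"
  proof (rule le_separation)
    fix j assume "j \<noteq> i"
    then show "\<psi> t * d i \<le> absval (x' $ i - x' $ j)"
      using order_trans[OF mult_left_mono[OF dle(1)] both] tpos by auto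
  qed (use n card in auto)
  show "absval (weierstrass f x' $ i) \<le> \<beta> t * w i"
  proof -
    \<comment> \<open>The counterpart of \<open>\<sigma> i\<close> with the new point in the
      denominators.\<close>
    define \<tau> where "\<tau> = (\<Sum>j\<in>UNIV - {i}. W j / (x' $ i - x $ j))"
    have mpos: "0 < absval (x' $ i - x $ j)" if "j \<noteq> i" for j
      using mult_pos_pos[OF \<kappa>(1) dpos[of i j]] mixed[of i j] that by fastforce
    then have mneq: "x' $ i - x $ j \<noteq> 0" if "j \<noteq> i" for j
      using that absval_pos_iff by blast
    have c0: "lead_coeff f \<noteq> 0" using deg n by auto
    have "poly f (x' $ i) = lead_coeff f * (\<Prod>j\<in>UNIV - {i}. x' $ i - x $ j)
        * (W i + (x' $ i - x $ i) * (1 + \<tau>))"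
      unfolding W_def \<tau>_def using mneq by (intro poly_eq_weierstrass[OF deg' x]) auto
    \<comment> \<open>Here \<open>1 - (1 - \<sigma> i) * (1 + \<tau>)\<close> is expanded. The
      constant terms cancel, and both the difference \<open>\<sigma> i - \<tau>\<close> and the
      product \<open>\<sigma> i * \<tau>\<close> are of second order in \<open>t\<close>.\<close>
    also have "W i + (x' $ i - x $ i) * (1 + \<tau>) = W i * ((\<sigma> i - \<tau>) + \<sigma> i * \<tau>)"
      unfolding x' by (simp add: algebra_simps)
    finally have W': "weierstrass f x' $ i
        = (\<Prod>j\<in>UNIV - {i}. (x' $ i - x $ j) / (x' $ i - x' $ j)) * (W i * ((\<sigma> i - \<tau>) + \<sigma> i * \<tau>))"
      using c0 by (simp add: weierstrass_def prod_dividef)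
    have \<tau>: "absval \<tau> \<le> a * t / \<kappa>"
    proof -
      have "absval (W j / (x' $ i - x $ j)) \<le> w j / d j / \<kappa>" if "j \<noteq> i" for j
      proof -
        have "\<kappa> * d j \<le> absval (x' $ i - x $ j)"
          using order_trans[OF mult_left_mono[OF dle(2)] mixed] \<kappa>(1) that by auto
        then have "w j / absval (x' $ i - x $ j) \<le> w j / (\<kappa> * d j)"
          using w \<kappa> d[of j] by (intro divide_left_mono) (auto simp: mpos that)
        then show ?thesis by (simp add: absval_divide w(1) mult.commute)
      qed
      then have "absval \<tau> \<le> (\<Sum>j\<in>UNIV - {i}. w j / d j / \<kappa>)"
        unfolding \<tau>_def by (intro order_trans[OF absval_sum_le] sum_mono) auto
      also have "\<dots> \<le> a * t / \<kappa>"
        unfolding sum_divide_distrib[symmetric] using others[of i] \<kappa> by (intro divide_right_mono) auto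
      finally show ?thesis .
    qed
    \<comment> \<open>Subtracting the reciprocals term by term leaves the extra factor
      \<open>(x' $ i - x $ i) / (x' $ i - x $ j)\<close>, which supplies the second power of
      \<open>t\<close>.\<close>
    have diff: "absval (\<sigma> i - \<tau>) \<le> a * t * (t * \<gamma> t / \<kappa>)"
    proof -
      have "absval (W j / (x $ i - x $ j) - W j / (x' $ i - x $ j)) \<le> w j / d j * (t * \<gamma> t / \<kappa>)"
        if "j \<noteq> i" for j
      proof -
        let ?D = "absval (x $ i - x $ j)" and ?D' = "absval (x' $ i - x $ j)"
        have ne: "x $ i - x $ j \<noteq> 0" using dpos[of i j] that absval_pos_iff by blast
        have "W j / (x $ i - x $ j) - W j / (x' $ i - x $ j)
            = W j / (x $ i - x $ j) * ((x' $ i - x $ i) / (x' $ i - x $ j))"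
          using ne mneq[OF that] by (simp add: field_simps)
        moreover have "absval ((x' $ i - x $ i) / (x' $ i - x $ j)) \<le> t * \<gamma> t / \<kappa>"
        proof -
          have "absval (x' $ i - x $ i) \<le> t * \<gamma> t * ?D" using shift'[of i j] that by auto
          also have "\<dots> \<le> t * \<gamma> t * (?D' / \<kappa>)"
            using mixed[of i j] that \<kappa> tpos \<gamma>1
            by (intro mult_left_mono) (auto simp: pos_le_divide_eq mult.commute)
          finally show ?thesis using mpos[OF that] by (simp add: absval_divide pos_divide_le_eq)
        qed
        ultimately show ?thesis
          using quot[OF that] w d[of j] by (auto simp only: absval_mult intro!: mult_mono absval_nonneg divide_nonneg_pos)
      qed
      then have "absval (\<sigma> i - \<tau>) \<le> (\<Sum>j\<in>UNIV - {i}. w j / d j * (t * \<gamma> t / \<kappa>))"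
        unfolding \<sigma>_def \<tau>_def sum_subtractf[symmetric]
        by (intro order_trans[OF absval_sum_le] sum_mono) auto
      also have "\<dots> \<le> a * t * (t * \<gamma> t / \<kappa>)"
        unfolding sum_distrib_right[symmetric] using others[of i] \<kappa> tpos \<gamma>1
        by (intro mult_right_mono) auto
      finally show ?thesis .
    qed
    \<comment> \<open>Each factor is one plus the shift of \<open>x $ j\<close> relative to the new
      distance. The Hoelder bound controls only the sum of these shifts, hence the passage to the
      arithmetic mean.\<close>
    have prod: "absval (\<Prod>j\<in>UNIV - {i}. (x' $ i - x $ j) / (x' $ i - x' $ j))
        \<le> (1 + a * t * (1 + a * t) / (real (n - 1) * \<psi> t)) ^ (n - 1)"
    proof -
      define y where "y j = 1 + \<gamma> t / \<psi> t * (w j / d j)" for j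
      have y1: "1 \<le> y j" for j using \<gamma>1 tpos w d[of j] by (simp add: y_def)
      have "absval ((x' $ i - x $ j) / (x' $ i - x' $ j)) \<le> y j" if "j \<noteq> i" for j
      proof -
        have ge: "\<psi> t * d j \<le> absval (x' $ i - x' $ j)"
          using order_trans[OF mult_left_mono[OF dle(2)] both] tpos that by auto
        have "(x' $ i - x $ j) / (x' $ i - x' $ j) = 1 + (x' $ j - x $ j) / (x' $ i - x' $ j)"
          using pos'[of i j] that by (auto simp: absval_pos_iff field_simps)
        then have "absval ((x' $ i - x $ j) / (x' $ i - x' $ j))
            \<le> 1 + absval (x' $ j - x $ j) / absval (x' $ i - x' $ j)"
          using absval_triangle[of 1 "(x' $ j - x $ j) / (x' $ i - x' $ j)"] by (simp add: absval_divide)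
        also have "absval (x' $ j - x $ j) / absval (x' $ i - x' $ j) \<le> (\<gamma> t * w j) / (\<psi> t * d j)"
          using ge shift[of j] tpos d[of j] \<gamma>1 w by (intro frac_le) auto
        finally show ?thesis by (simp add: y_def)
      qed
      then have "absval (\<Prod>j\<in>UNIV - {i}. (x' $ i - x $ j) / (x' $ i - x' $ j)) \<le> prod y (UNIV - {i})"
        unfolding absval_prod by (intro prod_mono) (auto simp: absval_nonneg)
      also have cardi: "card (UNIV - {i}) = n - 1" by (simp add: card card_Diff_singleton)
      then have "prod y (UNIV - {i}) \<le> (sum y (UNIV - {i}) / real (n - 1)) ^ (n - 1)"
        using prod_le_mean_power[of "UNIV - {i}" y] UNIV_minus_singleton_nonempty[of i] n card
          less_le_trans[OF zero_less_one y1] by simp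
      also have "sum y (UNIV - {i}) = real (n - 1) + \<gamma> t / \<psi> t * (\<Sum>j\<in>UNIV - {i}. w j / d j)"
        unfolding y_def sum.distrib sum_distrib_left sum_constant cardi by simp
      also have "(\<dots> / real (n - 1)) ^ (n - 1) \<le> ((real (n - 1) + \<gamma> t / \<psi> t * (a * t)) / real (n - 1)) ^ (n - 1)"
        using others[of i] \<gamma>1 tpos w d
        by (intro power_mono divide_right_mono add_left_mono mult_left_mono)
          (auto intro!: divide_nonneg_nonneg add_nonneg_nonneg mult_nonneg_nonneg sum_nonneg simp: less_imp_le)
      also have "(real (n - 1) + \<gamma> t / \<psi> t * (a * t)) / real (n - 1)
          = 1 + a * t * (1 + a * t) / (real (n - 1) * \<psi> t)"
        using n by (simp add: add_divide_distrib \<gamma>[of t, symmetric] mult_ac)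
      finally show ?thesis .
    qed
    have "absval ((\<sigma> i - \<tau>) + \<sigma> i * \<tau>) \<le> a * t * (t * \<gamma> t / \<kappa>) + a * t * (a * t / \<kappa>)"
    proof -
      have "absval (\<sigma> i * \<tau>) \<le> a * t * (a * t / \<kappa>)"
        unfolding absval_mult using a tpos by (intro mult_mono \<sigma> \<tau> absval_nonneg) auto
      then show ?thesis using diff absval_triangle[of "\<sigma> i - \<tau>" "\<sigma> i * \<tau>"] by linarith
    qed
    also have "\<dots> = a * t\<^sup>2 * (1 + a + a * t) / \<kappa>"
      using \<kappa> by (simp add: \<gamma> field_simps power2_eq_square)
    \<comment> \<open>The factor \<open>(1 + a t) / (1 - a t)\<close> is not sharp; it only serves to match the given \<open>\<beta>\<close>.\<close>
    also have "\<dots> \<le> (1 + a * t) / (1 - a * t) * (a * t\<^sup>2 * (1 + a + a * t) / \<kappa>)"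
    proof -
      have "1 \<le> (1 + a * t) / (1 - a * t)" using a tpos by simp
      moreover have "0 \<le> a * t\<^sup>2 * (1 + a + a * t) / \<kappa>" using a tpos \<kappa> by simp
      ultimately show ?thesis using mult_right_mono by fastforce
    qed
    finally have B: "absval ((\<sigma> i - \<tau>) + \<sigma> i * \<tau>)
        \<le> (1 + a * t) / (1 - a * t) * (a * t\<^sup>2 * (1 + a + a * t) / \<kappa>)" .
    have "absval (weierstrass f x' $ i)
        \<le> (1 + a * t * (1 + a * t) / (real (n - 1) * \<psi> t)) ^ (n - 1)
          * (w i * ((1 + a * t) / (1 - a * t) * (a * t\<^sup>2 * (1 + a + a * t) / \<kappa>)))"
      unfolding W' absval_mult w(1)[symmetric] using prod B w tpos a
      by (intro mult_mono) (auto simp: absval_nonneg intro!: mult_nonneg_nonneg zero_le_power add_nonneg_nonneg divide_nonneg_nonneg)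
    also have "\<dots> = \<beta> t * w i"
      by (simp add: \<beta> \<kappa>_def \<psi> mult_ac)
    finally show ?thesis .
  qed
qed

end

subsection \<open>Convergence\<close>

lemma half_pow3_Suc: "((3::nat) ^ Suc k - 1) div 2 = (3 ^ k - 1) div 2 + 3 ^ k"
  by simp

text \<open>Oddness of \<open>3 ^ k\<close> makes the integer division in the exponents
  exact.\<close>

lemma two_half_pow3: "Suc (2 * ((3 ^ k - 1) div 2)) = (3::nat) ^ k"
proof -
  have "odd ((3::nat) ^ k)" by simp
  then obtain m where "(3::nat) ^ k = 2 * m + 1" by (rule oddE)
  then show ?thesis by simp
qed

locale dochev_byrnev_iteration = dochev_byrnev_majorants n a b \<gamma> \<psi> \<beta> \<phi>
  for n :: nat and a b :: real and \<gamma> \<psi> \<beta> \<phi> :: "real \<Rightarrow> real" +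
  fixes f :: "'k::complete_normed_field poly" and x :: "nat \<Rightarrow> 'k ^ 'n::finite"
    and p q :: ereal and E :: "nat \<Rightarrow> real"
  assumes card: "n = CARD('n)" and deg: "degree f = n"
    and p: "1 \<le> p" and pq: "1 / p + 1 / q = 1"
    and a_eq: "a = real (n - 1) powr real_of_ereal (1 / q)"
    and b_eq: "b = 2 powr real_of_ereal (1 / q)"
    and iteration: "\<And>k. x (Suc k) = dochev_byrnev f (x k)"
    and E: "\<And>k. E k = weierstrass_E p f (x k)"
    and initial: "x 0 \<in> distinct_vecs" "admissible (E 0)" "\<phi> (E 0) \<le> 1"
begin

definition w :: "nat \<Rightarrow> 'n \<Rightarrow> real" where "w k i = absval (weierstrass f (x k) $ i)"

text \<open>The factor left by summing the geometric series with ratio \<open>\<beta> (E k)\<close>;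
  \<open>G k * w k i\<close> is both the error bound and the radius of the disk around
  \<open>x k $ i\<close>.\<close>

definition G :: "nat \<Rightarrow> real" where "G k = \<gamma> (E k) / (1 - \<beta> (E k))"

lemma deg': "degree f = CARD('n)" and two: "CARD('n) \<ge> 2"
  using card deg n by auto

lemma w_nonneg: "0 \<le> w k i"
  by (simp add: w_def absval_nonneg)

text \<open>These are the three assumptions of \<open>one_step\<close> with \<open>t = E k\<close>:
  the norm dominates each component, and Hoelder's inequality is applied to all indices but one and
  to a pair.\<close>

lemma
  assumes D: "x k \<in> distinct_vecs"
  shows E_nonneg: "0 \<le> E k"
    and single: "w k i / separation (x k) $ i \<le> E k"
    and others: "(\<Sum>j\<in>UNIV - {i}. w k j / separation (x k) $ j) \<le> a * E k"
    and pair: "i \<noteq> j \<Longrightarrow> w k i / separation (x k) $ i + w k j / separation (x k) $ j \<le> b * E k"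
proof -
  let ?v = "cone_quotient (weierstrass f (x k)) (separation (x k))"
  have v: "\<bar>?v $ i\<bar> = w k i / separation (x k) $ i" for i
    using separation_pos[OF D two, of i] by (simp add: cone_quotient_def w_def absval_nonneg)
  have N: "E k = lp_norm p ?v" by (simp add: E weierstrass_E_def)
  show single: "w k i / separation (x k) $ i \<le> E k" for i
    using component_le_lp_norm[OF p, of ?v i] by (simp only: v N)
  show "0 \<le> E k"
    using single[of i] w_nonneg[of k i] separation_pos[OF D two, of i]
    by (meson divide_nonneg_pos order_trans)
  have card_i: "card (UNIV - {i}) = n - 1" by (simp add: card card_Diff_singleton)
  show "(\<Sum>j\<in>UNIV - {i}. w k j / separation (x k) $ j) \<le> a * E k"
    using sum_le_lp_norm[OF p pq, of ?v "UNIV - {i}"] by (simp only: v N a_eq card_i)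
  show "w k i / separation (x k) $ i + w k j / separation (x k) $ j \<le> b * E k" if "i \<noteq> j"
    using sum_le_lp_norm[OF p pq, of ?v "{i, j}"] that by (simp add: v N b_eq)
qed

lemma
  assumes D: "x k \<in> distinct_vecs" and adm: "admissible (E k)"
  shows step_shift: "absval (x (Suc k) $ i - x k $ i) \<le> \<gamma> (E k) * w k i"
    and step_distinct: "x (Suc k) \<in> distinct_vecs"
    and step_separation: "\<psi> (E k) * separation (x k) $ i \<le> separation (x (Suc k)) $ i"
    and step_w: "w (Suc k) i \<le> \<beta> (E k) * w k i"
proof -
  note step = one_step[OF card deg D adm single[OF D, unfolded w_def] others[OF D, unfolded w_def]
    pair[OF D, unfolded w_def]]
  show "absval (x (Suc k) $ i - x k $ i) \<le> \<gamma> (E k) * w k i"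
    unfolding iteration w_def by (rule step(1))
  show "x (Suc k) \<in> distinct_vecs"
    unfolding iteration by (rule step(2))
  show "\<psi> (E k) * separation (x k) $ i \<le> separation (x (Suc k)) $ i"
    unfolding iteration by (rule step(3))
  show "w (Suc k) i \<le> \<beta> (E k) * w k i"
    unfolding iteration w_def by (rule step(4))
qed

text \<open>The corrections gain the factor \<open>\<beta>\<close> and the separations lose at most
  the factor \<open>\<psi>\<close>, so each quotient is scaled by at most
  \<open>\<beta> / \<psi> = \<phi>\<close>.\<close>

lemma step_E:
  assumes D: "x k \<in> distinct_vecs" and adm: "admissible (E k)"
  shows "E (Suc k) \<le> \<phi> (E k) * E k"
proof -
  let ?v = "\<lambda>k. cone_quotient (weierstrass f (x k)) (separation (x k))"
  have "lp_norm p (?v (Suc k)) \<le> \<phi> (E k) * lp_norm p (?v k)"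
  proof (rule lp_norm_mono_scaled[OF p])
    show "0 \<le> \<phi> (E k)" using adm by (rule \<phi>_nonneg)
    fix i
    have d: "0 < separation (x k) $ i" "0 < separation (x (Suc k)) $ i"
      using separation_pos[OF D two] separation_pos[OF step_distinct[OF D adm] two] by auto
    have \<psi>0: "0 < \<psi> (E k)" using adm by (simp add: admissible_def)
    have "w (Suc k) i / separation (x (Suc k)) $ i
        \<le> (\<beta> (E k) * w k i) / (\<psi> (E k) * separation (x k) $ i)"
      using step_w[OF D adm] step_separation[OF D adm] d \<psi>0 w_nonneg \<beta>_nonneg[OF adm]
      by (intro frac_le) auto
    then show "\<bar>cone_quotient (weierstrass f (x (Suc k))) (separation (x (Suc k))) $ i\<bar>
        \<le> \<phi> (E k) * \<bar>cone_quotient (weierstrass f (x k)) (separation (x k)) $ i\<bar>"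
      using d by (simp add: cone_quotient_def \<phi> w_def absval_nonneg)
  qed
  then show ?thesis by (simp only: E weierstrass_E_def)
qed

section \<open>Decay along the iteration\<close>

text \<open>The three properties are carried together: \<open>\<phi> (E k) \<le> 1\<close> prevents
  \<open>E\<close> from growing, and a smaller value stays admissible with a smaller
  \<open>\<phi>\<close>.\<close>

lemma invariant: "x k \<in> distinct_vecs \<and> admissible (E k) \<and> \<phi> (E k) \<le> 1"
proof (induction k)
  case 0
  then show ?case using initial by simp
next
  case (Suc k)
  then have D: "x k \<in> distinct_vecs" and adm: "admissible (E k)" and le: "\<phi> (E k) \<le> 1" by auto
  have D': "x (Suc k) \<in> distinct_vecs" by (rule step_distinct[OF D adm])
  have "E (Suc k) \<le> E k"
    using step_E[OF D adm] mult_right_mono[OF le E_nonneg[OF D]] by simp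
  then show ?case
    using admissible_mono[OF adm E_nonneg[OF D']] \<phi>_mono[OF adm E_nonneg[OF D']] le D' by auto
qed

lemma distinct: "x k \<in> distinct_vecs" and adm: "admissible (E k)" and \<phi>_le_one: "\<phi> (E k) \<le> 1"
  using invariant by auto

lemmas E0 = E_nonneg[OF distinct]

lemma \<beta>_E_less_one: "\<beta> (E k) < 1"
  by (rule \<beta>_less_one[OF adm \<phi>_le_one])

lemma E_Suc: "E (Suc k) \<le> \<phi> (E k) * E k"
  by (rule step_E[OF distinct adm])

lemma decseq_E: "decseq E"
proof (rule decseq_SucI)
  fix k
  show "E (Suc k) \<le> E k"
    using E_Suc[of k] mult_right_mono[OF \<phi>_le_one[of k] E0[of k]] by simp
qed

lemma admissible_scaled: "admissible (\<phi> (E k) * E k)"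
  using admissible_mono[OF adm, of "\<phi> (E k) * E k" k] E0[of k] \<phi>_nonneg[OF adm, of k] \<phi>_le_one[of k]
  by (simp add: mult_left_le_one_le)

text \<open>The scaling inequality with \<open>\<mu> = \<phi> (E k)\<close> contributes two powers
  in addition to the one already present.\<close>

lemma \<phi>_E_Suc: "\<phi> (E (Suc k)) \<le> \<phi> (E k) ^ 3"
proof -
  have "\<phi> (E (Suc k)) \<le> \<phi> (\<phi> (E k) * E k)"
    by (intro \<phi>_mono admissible_scaled E0 E_Suc)
  also have "\<dots> \<le> (\<phi> (E k))\<^sup>2 * \<phi> (E k)"
    by (intro \<phi>_scale adm \<phi>_nonneg \<phi>_le_one)
  finally show ?thesis by (simp add: power3_eq_cube power2_eq_square)
qed

lemma \<beta>_E_Suc: "\<beta> (E (Suc k)) \<le> \<psi> (E k) * \<phi> (E k) ^ 3"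
proof -
  have "\<beta> (E (Suc k)) \<le> \<beta> (\<phi> (E k) * E k)"
    by (intro \<beta>_mono admissible_scaled E0 E_Suc)
  also have "\<dots> \<le> (\<phi> (E k))\<^sup>2 * \<beta> (E k)"
    by (intro \<beta>_scale adm \<phi>_nonneg \<phi>_le_one)
  finally show ?thesis
    by (simp add: \<beta>_eq_\<psi>_\<phi>[OF adm] power3_eq_cube power2_eq_square mult_ac)
qed

lemma \<phi>_E_le: "\<phi> (E k) \<le> \<phi> (E 0) ^ (3 ^ k)"
proof (induction k)
  case (Suc k)
  have "\<phi> (E (Suc k)) \<le> (\<phi> (E 0) ^ (3 ^ k)) ^ 3"
    using \<phi>_E_Suc[of k] power_mono[OF Suc \<phi>_nonneg[OF adm], of 3] by linarith
  then show ?case by (simp only: power_Suc2 power_mult)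
qed simp

text \<open>The exponent is the sum of \<open>3 ^ j\<close> over \<open>j < k\<close>, one summand
  for each step.\<close>

lemma E_le: "E k \<le> \<phi> (E 0) ^ ((3 ^ k - 1) div 2) * E 0"
proof (induction k)
  case (Suc k)
  have "E (Suc k) \<le> \<phi> (E 0) ^ (3 ^ k) * (\<phi> (E 0) ^ ((3 ^ k - 1) div 2) * E 0)"
    using \<phi>_nonneg[OF adm, of 0]
    by (intro order_trans[OF E_Suc] mult_mono \<phi>_E_le Suc E0 zero_le_power)
  then show ?case by (simp only: half_pow3_Suc power_add mult_ac)
qed simp

text \<open>The scaling is applied once, directly from \<open>E 0\<close>. Going step by step would
  leave some \<open>\<psi> (E j)\<close>, which is at least \<open>\<psi> (E 0)\<close> because
  \<open>E\<close> decreases.\<close>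

lemma \<beta>_E_le: "\<beta> (E k) \<le> \<psi> (E 0) * \<phi> (E 0) ^ (3 ^ k)"
proof -
  let ?\<mu> = "\<phi> (E 0) ^ ((3 ^ k - 1) div 2)"
  have \<mu>: "0 \<le> ?\<mu>" "?\<mu> \<le> 1"
    using \<phi>_nonneg[OF adm, of 0] \<phi>_le_one[of 0] by (simp_all add: power_le_one)
  have "admissible (?\<mu> * E 0)"
    using admissible_mono[OF adm, of "?\<mu> * E 0" 0] \<mu> E0[of 0] by (simp add: mult_left_le_one_le)
  then have "\<beta> (E k) \<le> \<beta> (?\<mu> * E 0)"
    by (intro \<beta>_mono E0 E_le)
  also have "\<dots> \<le> ?\<mu>\<^sup>2 * \<beta> (E 0)"
    by (intro \<beta>_scale adm \<mu>)
  also have "\<dots> = \<psi> (E 0) * \<phi> (E 0) ^ Suc (2 * ((3 ^ k - 1) div 2))"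
    unfolding \<beta>_eq_\<psi>_\<phi>[OF adm] power_Suc power_even_eq by (simp only: mult_ac)
  finally show ?thesis by (simp only: two_half_pow3)
qed

lemma w_Suc: "w (Suc k) i \<le> \<beta> (E k) * w k i"
  by (rule step_w[OF distinct adm])

lemma w_le: "w k i \<le> \<psi> (E 0) ^ k * \<phi> (E 0) ^ ((3 ^ k - 1) div 2) * w 0 i"
proof (induction k)
  case (Suc k)
  have "w (Suc k) i \<le> (\<psi> (E 0) * \<phi> (E 0) ^ (3 ^ k))
      * (\<psi> (E 0) ^ k * \<phi> (E 0) ^ ((3 ^ k - 1) div 2) * w 0 i)"
    using \<phi>_nonneg[OF adm, of 0] adm[of 0]
    by (intro order_trans[OF w_Suc] mult_mono \<beta>_E_le Suc w_nonneg mult_nonneg_nonneg zero_le_power)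
      (auto simp: admissible_def)
  then show ?case by (simp only: half_pow3_Suc power_add power_Suc[of "\<psi> (E 0)"] mult_ac)
qed simp

lemma \<beta>_E_decreasing: "\<beta> (E (k + j)) \<le> \<beta> (E k)"
  by (intro \<beta>_mono adm E0 decseqD[OF decseq_E]) simp

text \<open>The ratio is frozen at index \<open>k\<close>, since \<open>\<beta> (E (k + j))\<close>
  never exceeds \<open>\<beta> (E k)\<close>.\<close>

lemma w_tail: "w (k + j) i \<le> w k i * \<beta> (E k) ^ j"
proof (induction j)
  case (Suc j)
  have "w (k + Suc j) i \<le> \<beta> (E (k + j)) * w (k + j) i" using w_Suc[of "k + j" i] by simp
  also have "\<dots> \<le> \<beta> (E k) * (w k i * \<beta> (E k) ^ j)"
    by (intro mult_mono \<beta>_E_decreasing Suc \<beta>_nonneg adm w_nonneg)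
  finally show ?case by (simp add: mult_ac)
qed simp

lemma steps_tail:
  "dist (x (k + Suc j) $ i) (x (k + j) $ i) \<le> \<gamma> (E k) * w k i * \<beta> (E k) ^ j"
proof -
  have "dist (x (k + Suc j) $ i) (x (k + j) $ i) \<le> \<gamma> (E (k + j)) * w (k + j) i"
    using step_shift[OF distinct adm, of "k + j"] by (simp add: dist_absval)
  also have "\<dots> \<le> \<gamma> (E k) * (w k i * \<beta> (E k) ^ j)"
    using \<gamma>_ge_one[OF E0, of k] decseqD[OF decseq_E, of k "k + j"]
    by (intro mult_mono w_tail \<gamma>_mono w_nonneg) auto
  finally show ?thesis by (simp add: mult_ac)
qed

lemma G_nonneg: "0 \<le> G k"
  using \<beta>_E_less_one[of k] \<gamma>_ge_one[OF E0, of k] by (simp add: G_def)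

lemma converges: "\<exists>\<xi>. x \<longlonglongrightarrow> \<xi>"
proof -
  have "\<exists>l. (\<lambda>k. x k $ i) \<longlonglongrightarrow> l" for i
    using geometric_steps(1)[OF \<beta>_nonneg[OF adm, of 0] \<beta>_E_less_one, of "\<lambda>k. x k $ i"]
      steps_tail[of 0 _ i] by fastforce
  then obtain l where "\<And>i. (\<lambda>k. x k $ i) \<longlonglongrightarrow> l i" by metis
  then have "x \<longlonglongrightarrow> (\<chi> i. l i)" by (intro vec_tendstoI) simp
  then show ?thesis by blast
qed

lemma stays_close: "absval (x k $ i - x 0 $ i) \<le> G 0 * w 0 i"
  using geometric_steps(2)[OF \<beta>_nonneg[OF adm, of 0] \<beta>_E_less_one, of "\<lambda>k. x k $ i"]
    steps_tail[of 0 _ i] by (auto simp: dist_absval G_def)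

lemma w_tendsto_0: "(\<lambda>k. w k i) \<longlonglongrightarrow> 0"
proof (rule tendsto_sandwich[OF _ _ tendsto_const])
  have "(\<lambda>k. w 0 i * \<beta> (E 0) ^ k) \<longlonglongrightarrow> w 0 i * 0"
    using \<beta>_nonneg[OF adm, of 0] \<beta>_E_less_one[of 0] by (intro tendsto_intros) auto
  then show "(\<lambda>k. w 0 i * \<beta> (E 0) ^ k) \<longlonglongrightarrow> 0" by simp
qed (use w_nonneg w_tail[of 0 _ i] in auto)

section \<open>Error estimates and identification of the limit\<close>

context
  fixes \<xi>
  assumes lim: "x \<longlonglongrightarrow> \<xi>"
begin

lemma error_bound: "absval (x k $ i - \<xi> $ i) \<le> G k * w k i"
proof -
  have "(\<lambda>j. x (k + j) $ i) \<longlonglongrightarrow> \<xi> $ i"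
    using tendsto_vec_nth[OF LIMSEQ_ignore_initial_segment[OF lim, of k]] by (simp add: add.commute)
  from geometric_steps(3)[OF \<beta>_nonneg[OF adm, of k] \<beta>_E_less_one _ this] steps_tail[of k _ i]
  show ?thesis by (auto simp: dist_absval G_def)
qed

text \<open>In \<open>error_bound\<close>, the quantities \<open>E k\<close>,
  \<open>\<beta> (E k)\<close> and \<open>w k i\<close> are replaced by their bounds in terms of the
  start.\<close>

lemma a_priori_bound:
  "absval (x k $ i - \<xi> $ i) \<le> \<gamma> (E 0 * \<phi> (E 0) ^ ((3 ^ k - 1) div 2))
    * (\<psi> (E 0) ^ k * \<phi> (E 0) ^ ((3 ^ k - 1) div 2) / (1 - \<psi> (E 0) * \<phi> (E 0) ^ (3 ^ k))) * w 0 i"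
proof -
  let ?h = "(3 ^ k - 1) div 2"
  have \<psi>0: "0 < \<psi> (E 0)" using adm[of 0] by (simp add: admissible_def)
  have "\<phi> (E 0) ^ (3 ^ k) \<le> \<phi> (E 0) ^ 1"
    using \<phi>_nonneg[OF adm, of 0] \<phi>_le_one[of 0] by (intro power_decreasing) auto
  then have "\<psi> (E 0) * \<phi> (E 0) ^ (3 ^ k) \<le> \<psi> (E 0) * \<phi> (E 0)"
    using \<psi>0 by (intro mult_left_mono) auto
  then have less: "\<psi> (E 0) * \<phi> (E 0) ^ (3 ^ k) < 1"
    using \<beta>_E_less_one[of 0] \<beta>_eq_\<psi>_\<phi>[OF adm, of 0] by simp
  have Ek: "E k \<le> E 0 * \<phi> (E 0) ^ ?h" using E_le[of k] by (simp only: mult.commute)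
  have "G k \<le> \<gamma> (E 0 * \<phi> (E 0) ^ ?h) / (1 - \<psi> (E 0) * \<phi> (E 0) ^ (3 ^ k))"
    unfolding G_def using less \<beta>_E_le[of k] \<gamma>_mono[OF Ek] \<gamma>_ge_one[OF E0, of k]
    by (intro frac_le) auto
  then have "G k * w k i \<le> \<gamma> (E 0 * \<phi> (E 0) ^ ?h) / (1 - \<psi> (E 0) * \<phi> (E 0) ^ (3 ^ k))
      * (\<psi> (E 0) ^ k * \<phi> (E 0) ^ ?h * w 0 i)"
    using less \<gamma>_ge_one[OF order_trans[OF E0 Ek]] by (intro mult_mono w_le w_nonneg) auto
  then show ?thesis using error_bound[of k i] by simp
qed

text \<open>This is \<open>error_bound\<close> at \<open>Suc k\<close>, where
  \<open>\<beta> (E (Suc k))\<close> is at most \<open>\<psi> (E k) * \<phi> (E k) ^ 3\<close> and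
  the new correction is at most \<open>\<psi> (E k) * \<phi> (E k)\<close> times the old
  one.\<close>

lemma a_posteriori_bound:
  "absval (x (Suc k) $ i - \<xi> $ i) \<le> \<psi> (E k) * \<phi> (E k) / (1 - \<psi> (E k) * \<phi> (E k) ^ 3)
    * \<gamma> (E (Suc k)) * w k i"
proof -
  have \<psi>0: "0 < \<psi> (E k)" using adm[of k] by (simp add: admissible_def)
  have "\<phi> (E k) ^ 3 \<le> \<phi> (E k) ^ 1"
    using \<phi>_nonneg[OF adm, of k] \<phi>_le_one[of k] by (intro power_decreasing) auto
  then have "\<psi> (E k) * \<phi> (E k) ^ 3 \<le> \<psi> (E k) * \<phi> (E k)"
    using \<psi>0 by (intro mult_left_mono) auto
  then have less: "\<psi> (E k) * \<phi> (E k) ^ 3 < 1"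
    using \<beta>_E_less_one[of k] \<beta>_eq_\<psi>_\<phi>[OF adm, of k] by simp
  have "G (Suc k) \<le> \<gamma> (E (Suc k)) / (1 - \<psi> (E k) * \<phi> (E k) ^ 3)"
    unfolding G_def using less \<beta>_E_Suc[of k] \<gamma>_ge_one[OF E0, of "Suc k"]
    by (intro divide_left_mono mult_pos_pos) auto
  then have "G (Suc k) * w (Suc k) i
      \<le> \<gamma> (E (Suc k)) / (1 - \<psi> (E k) * \<phi> (E k) ^ 3) * (\<psi> (E k) * \<phi> (E k) * w k i)"
    using less \<gamma>_ge_one[OF E0, of "Suc k"] w_Suc[of k i]
    unfolding \<beta>_eq_\<psi>_\<phi>[OF adm] by (intro mult_mono w_nonneg) auto
  then show ?thesis using error_bound[of "Suc k" i] by (simp add: mult_ac)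
qed

text \<open>In the interpolation identity at \<open>x k\<close> the left side does not depend on
  \<open>k\<close>, while on the right the corrections vanish in the limit. Only the product with
  roots \<open>\<xi> $ i\<close> remains.\<close>

lemma root: "root_vector f \<xi>"
  unfolding root_vector_def
proof (rule poly_eqI)
  fix m
  define g where "g k = coeff (monic_from_roots (x k)) m
    + (\<Sum>j\<in>UNIV. weierstrass f (x k) $ j * coeff (\<Prod>l\<in>UNIV - {j}. [:- (x k $ l), 1:]) m)" for k
  have f: "coeff f m = lead_coeff f * g k" for k
  proof -
    have "coeff f m = coeff (smult (lead_coeff f) (monic_from_roots (x k) + (\<Sum>j\<in>UNIV.
        smult (weierstrass f (x k) $ j) (\<Prod>l\<in>UNIV - {j}. [:- (x k $ l), 1:])))) m"
      by (rule arg_cong[OF weierstrass_decomposition[OF deg' distinct]])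
    also have "\<dots> = lead_coeff f * g k"
      unfolding g_def coeff_smult coeff_add coeff_sum ..
    finally show ?thesis .
  qed
  have W: "(\<lambda>k. weierstrass f (x k) $ j) \<longlonglongrightarrow> 0" for j
    by (rule absval_tendstoI[OF w_tendsto_0[of j]]) (simp add: w_def)
  have "g \<longlonglongrightarrow> coeff (monic_from_roots \<xi>) m
      + (\<Sum>j\<in>UNIV. 0 * coeff (\<Prod>l\<in>UNIV - {j}. [:- (\<xi> $ l), 1:]) m)"
    unfolding g_def monic_from_roots_def
    by (intro absval_tendsto_add absval_tendsto_sum absval_tendsto_mult W coeff_prod_linear_tendsto lim)
  from absval_tendsto_mult[OF tendsto_const this, of "lead_coeff f"]
  have "(\<lambda>k. lead_coeff f * g k) \<longlonglongrightarrow> lead_coeff f * coeff (monic_from_roots \<xi>) m"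
    by (simp only: mult_zero_left sum.neutral_const add_0_right)
  then have "(\<lambda>k::nat. coeff f m) \<longlonglongrightarrow> lead_coeff f * coeff (monic_from_roots \<xi>) m"
    unfolding f[symmetric] .
  from LIMSEQ_unique[OF tendsto_const this]
  show "coeff f m = coeff (smult (lead_coeff f) (monic_from_roots \<xi>)) m"
    by (simp only: coeff_smult)
qed

lemma factorization: "f = smult (lead_coeff f) (monic_from_roots \<xi>)"
  using root unfolding root_vector_def .

lemma poly_f: "poly f z = lead_coeff f * (\<Prod>j\<in>UNIV. z - \<xi> $ j)"
  by (subst factorization) (simp add: monic_from_roots_def poly_prod)

lemma zero_iff: "poly f z = 0 \<longleftrightarrow> z \<in> range (\<lambda>i. \<xi> $ i)"
proof -
  have "lead_coeff f \<noteq> 0" using deg n by auto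
  then show ?thesis by (auto simp: poly_f)
qed

section \<open>Simple zeros and separated disks\<close>

context
  assumes contraction: "\<phi> (E 0) < 1"
begin

lemma bEG: "b * E k * G k < 1"
proof -
  have "\<phi> (E k) < 1"
    using \<phi>_mono[OF adm E0 decseqD[OF decseq_E], of 0 k] contraction by simp
  then have "\<beta> (E k) < \<psi> (E k)" using adm[of k] by (simp add: \<phi> admissible_def)
  then have "b * E k * \<gamma> (E k) < 1 - \<beta> (E k)" by (simp add: \<psi>_eq mult_ac)
  then show ?thesis using \<beta>_E_less_one[of k] by (simp add: G_def pos_divide_less_eq)
qed

lemma absval_diff_pos: "i \<noteq> j \<Longrightarrow> 0 < absval (x k $ i - x k $ j)"
  using distinct[of k] by (auto simp: absval_pos_iff distinct_vecs_iff)

text \<open>Each separation is at most the distance of the pair, so the two-index Hoelder bound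
  controls the sum of the radii; \<open>bEG\<close> then makes it strictly smaller than the distance
  of the centres.\<close>

lemma radii_le:
  assumes "i \<noteq> j"
  shows "G k * w k i + G k * w k j \<le> b * E k * G k * absval (x k $ i - x k $ j)"
proof -
  let ?D = "absval (x k $ i - x k $ j)" and ?d = "\<lambda>i. separation (x k) $ i"
  have d: "0 < ?d i" for i by (rule separation_pos[OF distinct two])
  have "w k i + w k j = w k i / ?d i * ?d i + w k j / ?d j * ?d j"
    using d[of i] d[of j] by simp
  also have "\<dots> \<le> w k i / ?d i * ?D + w k j / ?d j * ?D"
    using separation_le[OF assms, of "x k"] separation_le[OF assms[symmetric], of "x k"] w_nonneg d
    by (intro add_mono mult_left_mono) (auto simp: less_imp_le absval_minus_commute)
  also have "\<dots> \<le> b * E k * ?D"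
    using mult_right_mono[OF pair[OF distinct assms, of k], of ?D]
    by (simp add: absval_nonneg distrib_right)
  finally have "G k * (w k i + w k j) \<le> G k * (b * E k * ?D)"
    by (intro mult_left_mono G_nonneg)
  then show ?thesis by (simp add: algebra_simps)
qed

lemma radii_less:
  assumes "i \<noteq> j"
  shows "G k * w k i + G k * w k j < absval (x k $ i - x k $ j)"
  using radii_le[OF assms, of k] mult_strict_right_mono[OF bEG[of k] absval_diff_pos[OF assms, of k]] by simp

text \<open>Equal components of the limit would be a common point of two initial disks.\<close>

lemma \<xi>_distinct: "i \<noteq> j \<Longrightarrow> \<xi> $ i \<noteq> \<xi> $ j"
proof
  assume ij: "i \<noteq> j" and eq: "\<xi> $ i = \<xi> $ j"
  have "absval (x 0 $ i - x 0 $ j) \<le> absval (x 0 $ i - \<xi> $ i) + absval (x 0 $ j - \<xi> $ j)"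
    using absval_diff_triangle[of "x 0 $ i - \<xi> $ i" "x 0 $ j - \<xi> $ j"] by (simp add: eq)
  then show False
    using error_bound[of 0 i] error_bound[of 0 j] radii_less[OF ij, of 0] by linarith
qed

lemma \<xi>_distinct_vecs: "\<xi> \<in> distinct_vecs"
  using \<xi>_distinct by (simp add: distinct_vecs_iff)

lemma simple_zero:
  assumes "poly f z = 0"
  shows "order z f = 1"
proof -
  obtain i where z: "z = \<xi> $ i" using assms zero_iff by auto
  define Q where "Q = smult (lead_coeff f) (\<Prod>j\<in>UNIV - {i}. [:- (\<xi> $ j), 1:])"
  have f0: "f \<noteq> 0" using deg n by auto
  have "monic_from_roots \<xi> = [:- z, 1:] * (\<Prod>j\<in>UNIV - {i}. [:- (\<xi> $ j), 1:])"
    unfolding monic_from_roots_def z by (intro prod.remove) auto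
  then have f: "f = [:- z, 1:] * Q"
    unfolding Q_def mult_smult_right by (metis factorization)
  have "poly Q z \<noteq> 0"
    using f0 \<xi>_distinct by (auto simp: Q_def poly_prod z)
  then have "order z Q = 0" by (rule order_0I)
  moreover have "order z [:- z, 1:] = 1" using order_power_n_n[of z 1] by simp
  ultimately show ?thesis using order_mult[of "[:- z, 1:]" Q z] f0 by (metis f add.right_neutral)
qed

lemma card_zeros: "card {z. poly f z = 0} = n"
proof -
  have "{z. poly f z = 0} = range (\<lambda>i. \<xi> $ i)" using zero_iff by auto
  moreover have "inj (\<lambda>i. \<xi> $ i)" using \<xi>_distinct by (auto simp: inj_def)
  ultimately show ?thesis by (simp add: card_image card)
qed

lemma disks_disjoint: "disjoint_family (\<lambda>i. cball (x k $ i) (G k * w k i))"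
  unfolding disjoint_family_on_def
proof (intro ballI impI equals0I)
  fix i j z assume ij: "i \<noteq> j" and "z \<in> cball (x k $ i) (G k * w k i) \<inter> cball (x k $ j) (G k * w k j)"
  then have "dist (x k $ i) (x k $ j) \<le> G k * w k i + G k * w k j"
    using dist_triangle2[of "x k $ i" "x k $ j" z] by auto
  then show False using radii_less[OF ij, of k] by (simp add: dist_absval)
qed

text \<open>Every zero is some \<open>\<xi> $ j\<close> and lies in the disk with index
  \<open>j\<close>; disjointness then excludes all indices but \<open>i\<close>.\<close>

lemma disk_zero: "\<exists>!z. z \<in> cball (x k $ i) (G k * w k i) \<and> poly f z = 0"
proof
  have mem: "\<xi> $ i \<in> cball (x k $ i) (G k * w k i)" for i
    using error_bound[of k i] by (simp add: dist_absval)
  show "\<xi> $ i \<in> cball (x k $ i) (G k * w k i) \<and> poly f (\<xi> $ i) = 0"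
    using mem zero_iff by auto
  fix z assume z: "z \<in> cball (x k $ i) (G k * w k i) \<and> poly f z = 0"
  then obtain j where j: "z = \<xi> $ j" using zero_iff by auto
  then have "z \<in> cball (x k $ i) (G k * w k i) \<inter> cball (x k $ j) (G k * w k j)"
    using z mem by auto
  then have "i = j" using disjoint_family_onD[OF disks_disjoint[of k], of i j] by fast
  then show "z = \<xi> $ i" using j by simp
qed

section \<open>Cubic order of convergence\<close>

text \<open>A converse to \<open>error_bound\<close>. The factored form of \<open>f\<close> splits
  \<open>x k $ i - \<xi> $ i\<close> off the correction. Each of the \<open>n - 1\<close> remaining
  quotients is at most two, because \<open>\<xi> $ j\<close> is closer to \<open>x k $ j\<close>
  than \<open>x k $ i\<close> is.\<close>

lemma w_le_error: "w k i \<le> 2 ^ (n - 1) * absval (x k $ i - \<xi> $ i)"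
proof -
  let ?x = "\<lambda>i. x k $ i"
  have c0: "lead_coeff f \<noteq> 0" using deg n by auto
  have "(\<Prod>j\<in>UNIV. ?x i - \<xi> $ j) = (?x i - \<xi> $ i) * (\<Prod>j\<in>UNIV - {i}. ?x i - \<xi> $ j)"
    by (intro prod.remove) auto
  then have "weierstrass f (x k) $ i = (?x i - \<xi> $ i) * (\<Prod>j\<in>UNIV - {i}. (?x i - \<xi> $ j) / (?x i - ?x j))"
    using c0 by (simp add: weierstrass_def poly_f prod_dividef)
  then have "w k i = absval (?x i - \<xi> $ i) * (\<Prod>j\<in>UNIV - {i}. absval ((?x i - \<xi> $ j) / (?x i - ?x j)))"
    by (simp add: w_def absval_mult absval_prod)
  also have "\<dots> \<le> absval (?x i - \<xi> $ i) * (\<Prod>j\<in>UNIV - {i}. 2)"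
  proof (intro mult_left_mono prod_mono conjI absval_nonneg)
    fix j assume "j \<in> UNIV - {i}"
    then have ij: "i \<noteq> j" by auto
    have "absval (?x i - \<xi> $ j) \<le> absval (?x i - ?x j) + absval (?x j - \<xi> $ j)"
      using absval_triangle[of "?x i - ?x j" "?x j - \<xi> $ j"] by simp
    also have "\<dots> \<le> 2 * absval (?x i - ?x j)"
      using error_bound[of k j] radii_less[OF ij, of k] mult_nonneg_nonneg[OF G_nonneg w_nonneg, of k k i]
      by linarith
    finally show "absval ((?x i - \<xi> $ j) / (?x i - ?x j)) \<le> 2"
      using absval_diff_pos[OF ij, of k] by (simp add: absval_divide pos_divide_le_eq)
  qed
  finally show ?thesis by (simp add: card card_Diff_singleton mult.commute)
qed

text \<open>Both points stay within their radii, whose sum is below the distance of the centres.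
  This bounds the separations of all iterates away from zero by one constant.\<close>

lemma separation_limit_le: "separation \<xi> $ i \<le> 2 * separation (x k) $ i"
proof -
  have "separation \<xi> $ i / 2 \<le> separation (x k) $ i"
  proof (rule le_separation[OF two])
    fix j assume "j \<noteq> i"
    then have ij: "i \<noteq> j" by simp
    have "absval (\<xi> $ i - \<xi> $ j)
        \<le> absval (x k $ i - x k $ j) + absval ((x k $ i - \<xi> $ i) - (x k $ j - \<xi> $ j))"
      using absval_diff_triangle[of "x k $ i - x k $ j" "(x k $ i - \<xi> $ i) - (x k $ j - \<xi> $ j)"]
      by simp
    also have "\<dots> \<le> 2 * absval (x k $ i - x k $ j)"
      using absval_diff_triangle[of "x k $ i - \<xi> $ i" "x k $ j - \<xi> $ j"]
        error_bound[of k i] error_bound[of k j] radii_less[OF ij, of k] by linarith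
    finally show "separation \<xi> $ i / 2 \<le> absval (x k $ i - x k $ j)"
      using separation_le[OF ij, of \<xi>] by simp
  qed
  then show ?thesis by simp
qed

lemma E_le_error: "\<exists>C\<ge>0. \<forall>k. E k \<le> C * dist (x k) \<xi>"
proof -
  define \<delta> where "\<delta> = Min (range (\<lambda>i. separation \<xi> $ i))"
  have \<delta>: "0 < \<delta>" using separation_pos[OF \<xi>_distinct_vecs two] by (auto simp: \<delta>_def)
  have sep: "\<delta> / 2 \<le> separation (x k) $ i" for k i
  proof -
    have "\<delta> \<le> separation \<xi> $ i" by (simp add: \<delta>_def)
    then show ?thesis using separation_limit_le[of i k] by linarith
  qed
  define C where "C = 2 ^ (n - 1) / (\<delta> / 2)"
  have C: "0 \<le> C" using \<delta> by (simp add: C_def)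
  \<comment> \<open>A bound common to all components is a multiple of the all-ones vector.\<close>
  define N where "N = lp_norm p (1 :: real ^ 'n)"
  have bound: "E k \<le> C * dist (x k) \<xi> * N" for k
    unfolding E weierstrass_E_def N_def
  proof (rule lp_norm_mono_scaled[OF p])
    show "0 \<le> C * dist (x k) \<xi>" using C by simp
    fix i
    have "w k i \<le> 2 ^ (n - 1) * dist (x k) \<xi>"
      using w_le_error[of k i] dist_vec_nth_le[of "x k" i \<xi>]
      by (intro order_trans[OF w_le_error] mult_left_mono) (auto simp: dist_absval)
    then have "w k i / separation (x k) $ i \<le> (2 ^ (n - 1) * dist (x k) \<xi>) / (\<delta> / 2)"
      using sep[of k i] \<delta> by (intro frac_le) auto
    also have "\<dots> = C * dist (x k) \<xi>" by (simp add: C_def)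
    finally show "\<bar>cone_quotient (weierstrass f (x k)) (separation (x k)) $ i\<bar>
        \<le> C * dist (x k) \<xi> * \<bar>(1 :: real ^ 'n) $ i\<bar>"
      using separation_pos[OF distinct two, of k i]
      by (simp add: cone_quotient_def w_def absval_nonneg)
  qed
  have N: "0 \<le> N"
    unfolding N_def by (rule order_trans[OF abs_ge_zero component_le_lp_norm[OF p]])
  show ?thesis
  proof (intro exI conjI allI)
    show "0 \<le> C * N" using C N by simp
    show "E k \<le> C * N * dist (x k) \<xi>" for k
      using bound[of k] by (metis mult.assoc mult.commute)
  qed
qed

lemma G_le: "G k \<le> G 0"
  unfolding G_def
  using \<gamma>_ge_one[OF E0, of 0] \<gamma>_mono[OF decseqD[OF decseq_E], of 0 k] \<beta>_E_decreasing[of 0 k] \<beta>_E_less_one[of 0]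
  by (intro frac_le) auto

text \<open>The next error is at most \<open>G 0 * (\<beta> (E k) * w k i)\<close>. Two powers of
  the current error come from \<open>\<beta> t = t\<^sup>2 * step_quotient t\<close> with
  \<open>E k\<close> linear in the error, and the third from \<open>w k i\<close>. The factor
  \<open>n\<close> comes from summing the components.\<close>

lemma cubic: "converges_cubically x \<xi>"
proof -
  obtain C where C: "0 \<le> C" "\<And>k. E k \<le> C * dist (x k) \<xi>" using E_le_error by blast
  define K where "K = G 0 * (C\<^sup>2 * step_quotient (E 0)) * 2 ^ (n - 1)"
  have "dist (x (Suc k)) \<xi> \<le> real n * K * dist (x k) \<xi> ^ 3" for k
  proof -
    let ?D = "dist (x k) \<xi>"
    have "dist (x (Suc k) $ i) (\<xi> $ i) \<le> K * ?D ^ 3" for i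
    proof -
      have Q: "step_quotient (E k) \<le> step_quotient (E 0)" "0 \<le> step_quotient (E k)"
        using step_quotient_mono[OF adm E0 decseqD[OF decseq_E], of 0 k] step_quotient_nonneg[OF adm]
        by auto
      have \<beta>: "\<beta> (E k) \<le> (C * ?D)\<^sup>2 * step_quotient (E 0)"
        unfolding \<beta>_eq using Q E0[of k] C(2)[of k] by (intro mult_mono power_mono) auto
      have w: "w k i \<le> 2 ^ (n - 1) * ?D"
        using dist_vec_nth_le[of "x k" i \<xi>]
        by (intro order_trans[OF w_le_error] mult_left_mono) (auto simp: dist_absval)
      have "dist (x (Suc k) $ i) (\<xi> $ i) \<le> G (Suc k) * w (Suc k) i"
        using error_bound[of "Suc k" i] by (simp add: dist_absval)
      also have "\<dots> \<le> G 0 * (\<beta> (E k) * w k i)"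
        by (intro mult_mono G_le w_Suc G_nonneg w_nonneg)
      also have "\<dots> \<le> G 0 * (((C * ?D)\<^sup>2 * step_quotient (E 0)) * (2 ^ (n - 1) * ?D))"
        using Q by (intro mult_left_mono mult_mono \<beta> w G_nonneg w_nonneg) auto
      also have "\<dots> = K * ?D ^ 3"
        by (simp only: K_def power_mult_distrib power3_eq_cube power2_eq_square mult_ac)
      finally show ?thesis .
    qed
    then have "(\<Sum>i\<in>UNIV. dist (x (Suc k) $ i) (\<xi> $ i)) \<le> (\<Sum>i\<in>(UNIV :: 'n set). K * ?D ^ 3)"
      by (intro sum_mono)
    moreover have "dist (x (Suc k)) \<xi> \<le> (\<Sum>i\<in>UNIV. dist (x (Suc k) $ i) (\<xi> $ i))"
      unfolding dist_vec_def by (rule L2_set_le_sum) simp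
    moreover have "(\<Sum>i\<in>(UNIV :: 'n set). K * ?D ^ 3) = real n * K * ?D ^ 3"
      by (simp add: card)
    ultimately show ?thesis by linarith
  qed
  then show ?thesis using lim unfolding converges_cubically_def by blast
qed

end

end

end

section \<open>Assembly of the convergence theorem\<close>

theorem theorem4p5:
  fixes f :: "'k::complete_normed_field poly"
    and n :: nat and p q :: ereal and a b :: real
    and \<gamma> \<psi> \<beta> \<phi> :: "real \<Rightarrow> real"
    and x :: "nat \<Rightarrow> 'k ^ 'n::finite"
    and E :: "nat \<Rightarrow> real" and W :: "nat \<Rightarrow> 'k ^ 'n" and r :: "nat \<Rightarrow> 'n \<Rightarrow> real"
  assumes n: "n = CARD('n)" "n \<ge> 2" "degree f = n"
    and pq: "1 \<le> p" "1 \<le> q" "1 / p + 1 / q = 1"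
    and a: "a = real (n - 1) powr real_of_ereal (1 / q)"
    and b: "b = 2 powr real_of_ereal (1 / q)"
    and \<gamma>: "\<And>t. \<gamma> t = 1 + a * t"
    and \<psi>: "\<And>t. \<psi> t = 1 - b * t - a * b * t\<^sup>2"
    and \<beta>: "\<And>t. \<beta> t =
          a * t\<^sup>2 * (1 + a * t) * (1 + a + a * t) / ((1 - a * t) * (1 - t - a * t\<^sup>2))
          * (1 + a * t * (1 + a * t) / (real (n - 1) * (1 - b * t - a * b * t\<^sup>2))) ^ (n - 1)"
    and \<phi>: "\<And>t. \<phi> t = \<beta> t / \<psi> t"
    and iteration: "\<And>k. x (Suc k) = dochev_byrnev f (x k)"
    and E: "\<And>k. E k = weierstrass_E p f (x k)"
    and W: "\<And>k. W k = weierstrass f (x k)"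
    and r: "\<And>k i. r k i = \<gamma> (E k) / (1 - \<beta> (E k)) * absval (W k $ i)"
    and initial: "x 0 \<in> distinct_vecs"
      "E 0 < min (1 / a) (2 / (b + sqrt (b\<^sup>2 + 4 * a * b)))"
      "\<phi> (E 0) \<le> 1"
  shows "\<exists>\<xi>. root_vector f \<xi>
    \<comment> \<open>(i)\<close>
    \<and> (\<forall>k. x k \<in> distinct_vecs)
    \<and> (\<forall>k. x k \<in> cone_cball (x 0) ((\<gamma> (E 0) / (1 - \<beta> (E 0))) *\<^sub>R cone_norm (W 0)))
    \<and> x \<longlonglongrightarrow> \<xi>
    \<and> (\<phi> (E 0) < 1 \<longrightarrow> converges_cubically x \<xi>)
    \<comment> \<open>(ii)\<close>
    \<and> (let lam = \<phi> (E 0); \<theta> = \<psi> (E 0); A = (\<lambda>k. \<gamma> (E 0 * lam ^ ((3 ^ k - 1) div 2)))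
       in \<forall>k. cone_norm (x k - \<xi>) \<le>
            (A k * (\<theta> ^ k * lam ^ ((3 ^ k - 1) div 2) / (1 - \<theta> * lam ^ (3 ^ k))))
              *\<^sub>R cone_norm (W 0))
    \<comment> \<open>(iii)\<close>
    \<and> (\<forall>k. cone_norm (x k - \<xi>) \<le> (\<gamma> (E k) / (1 - \<beta> (E k))) *\<^sub>R cone_norm (W k))
    \<comment> \<open>(iv)\<close>
    \<and> (let lam = (\<lambda>k. \<phi> (E k)); \<theta> = (\<lambda>k. \<psi> (E k))
       in \<forall>k. cone_norm (x (Suc k) - \<xi>) \<le>
            (\<theta> k * lam k / (1 - \<theta> k * lam k ^ 3) * \<gamma> (E (Suc k))) *\<^sub>R cone_norm (W k))
    \<comment> \<open>(v)\<close>
    \<and> (\<phi> (E 0) < 1 \<longrightarrow>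
         card {z. poly f z = 0} = n \<and> (\<forall>z. poly f z = 0 \<longrightarrow> order z f = 1)
         \<and> (\<forall>k. disjoint_family (\<lambda>i. cball (x k $ i) (r k i))
                \<and> (\<forall>i. \<exists>!z. z \<in> cball (x k $ i) (r k i) \<and> poly f z = 0)))"
proof -
  have exponent: "0 \<le> real_of_ereal (1 / q)"
    using order_trans[OF _ pq(2), of 0]
    by (intro real_of_ereal_pos) (simp add: divide_ereal_def ereal_inverse_nonneg_iff)
  have a1: "1 \<le> a" and b1: "1 \<le> b"
    unfolding a b using n(2) exponent by (auto intro!: ge_one_powr_ge_zero)
  interpret majorants: dochev_byrnev_majorants n a b \<gamma> \<psi> \<beta> \<phi>
    by unfold_locales (fact n(2) a1 b1 \<gamma> \<psi> \<beta> \<phi>)+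
  have "0 \<le> E 0"
    unfolding E weierstrass_E_def by (rule order_trans[OF abs_ge_zero component_le_lp_norm[OF pq(1)]])
  moreover have "a * E 0 < 1"
    using initial(2) a1 by (simp add: pos_less_divide_eq mult.commute)
  moreover have "0 < \<psi> (E 0)"
  proof -
    \<comment> \<open>From \<open>t * (b + s) < 2\<close> follows \<open>t * s < 2 - b * t\<close>.
      Both sides are nonnegative; squaring cancels \<open>b\<^sup>2 * t\<^sup>2\<close> and leaves
      four times the inequality \<open>0 < \<psi> t\<close>.\<close>
    define t s where "t = E 0" and "s = sqrt (b\<^sup>2 + 4 * a * b)"
    have s: "0 < s" "s\<^sup>2 = b\<^sup>2 + 4 * a * b"
      using a1 b1 by (auto simp: s_def add_pos_pos)
    have t: "0 \<le> t" "t < 2 / (b + s)" using \<open>0 \<le> E 0\<close> initial(2) by (auto simp: t_def s_def)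
    then have "t * s < 2 - b * t" using s b1 by (simp add: pos_less_divide_eq algebra_simps)
    then have "(t * s)\<^sup>2 < (2 - b * t)\<^sup>2"
      using s t by (intro power_strict_mono) auto
    then have "t\<^sup>2 * (b\<^sup>2 + 4 * a * b) < (2 - b * t)\<^sup>2"
      by (simp only: power_mult_distrib s(2))
    then show ?thesis
      unfolding \<psi> t_def[symmetric] by (simp add: power2_eq_square algebra_simps)
  qed
  ultimately have adm0: "majorants.admissible (E 0)" by (simp add: majorants.admissible_def)
  interpret dochev_byrnev_iteration n a b \<gamma> \<psi> \<beta> \<phi> f x p q E
    by unfold_locales (fact n(1,3) pq(1,3) a b iteration E initial(1,3) adm0)+
  obtain \<xi> where lim: "x \<longlonglongrightarrow> \<xi>" using converges by blast
  have r': "r k i = G k * w k i" for k i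
    by (simp add: r G_def w_def W)
  show ?thesis
    unfolding Let_def r' card[symmetric]
  proof (intro exI[of _ \<xi>] conjI allI impI)
    show "root_vector f \<xi>" by (rule root[OF lim])
    show "x k \<in> distinct_vecs" for k by (rule distinct)
    show "x k \<in> cone_cball (x 0) ((\<gamma> (E 0) / (1 - \<beta> (E 0))) *\<^sub>R cone_norm (W 0))" for k
      using stays_close[of k] by (simp add: cone_cball_def cone_norm_def less_eq_vec_def G_def w_def W)
    show "x \<longlonglongrightarrow> \<xi>" by (rule lim)
    show "converges_cubically x \<xi>" if "\<phi> (E 0) < 1"
      by (rule cubic[OF lim that])
    show "cone_norm (x k - \<xi>) \<le> (\<gamma> (E 0 * \<phi> (E 0) ^ ((3 ^ k - 1) div 2)) *
        (\<psi> (E 0) ^ k * \<phi> (E 0) ^ ((3 ^ k - 1) div 2) / (1 - \<psi> (E 0) * \<phi> (E 0) ^ 3 ^ k)))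
        *\<^sub>R cone_norm (W 0)" for k
      using a_priori_bound[OF lim, of k]
      by (simp only: cone_norm_def less_eq_vec_def w_def W vector_scaleR_component vec_lambda_beta
          vector_minus_component real_scaleR_def simp_thms)
    show "cone_norm (x k - \<xi>) \<le> (\<gamma> (E k) / (1 - \<beta> (E k))) *\<^sub>R cone_norm (W k)" for k
      using error_bound[OF lim, of k]
      by (simp add: cone_norm_def less_eq_vec_def G_def w_def W)
    show "cone_norm (x (Suc k) - \<xi>) \<le> (\<psi> (E k) * \<phi> (E k) / (1 - \<psi> (E k) * \<phi> (E k) ^ 3)
        * \<gamma> (E (Suc k))) *\<^sub>R cone_norm (W k)" for k
      using a_posteriori_bound[OF lim, of k]
      by (simp only: cone_norm_def less_eq_vec_def w_def W vector_scaleR_component vec_lambda_beta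
          vector_minus_component real_scaleR_def simp_thms)
    assume less: "\<phi> (E 0) < 1"
    show "card {z. poly f z = 0} = n" by (rule card_zeros[OF lim less])
    show "order z f = 1" if "poly f z = 0" for z by (rule simple_zero[OF lim less that])
    show "disjoint_family (\<lambda>i. cball (x k $ i) (G k * w k i))" for k
      by (rule disks_disjoint[OF lim less])
    show "\<exists>!z. z \<in> cball (x k $ i) (G k * w k i) \<and> poly f z = 0" for k i
      by (rule disk_zero[OF lim less])
  qed
qed

end
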